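(* Let $x:[0,+\infty)\to\mathbb{R}$ be a càdlàg path such that $\sum_{0<s\le t}(\Delta x_s)^2<+\infty$ for any $t>0$. Let $\mathcal{X}=(x^{\varepsilon})_{\varepsilon>0}$ be a family of càdlàg paths $x^{\varepsilon}:[0,+\infty)\to\mathbb{R}$ such that, for every $\varepsilon>0$, $\sup_{s\ge 0}|x_s-x_s^{\varepsilon}|\le\varepsilon$ and $x^{\varepsilon}$ has finite total variation on compacts, and such that the limit $$\langle x\rangle_t:=2\lim_{\varepsilon\to 0+}\int_0^t (x_s-x_s^{\varepsilon})\,\mathrm{d}x_s^{\varepsilon},\qquad t\ge 0,$$ exists uniformly on compact sets of $t$. Moreover, assume that for every $t>0$ $$\sup_{\varepsilon>0}\int_0^t|x_s-x_s^{\varepsilon}|\,|\mathrm{d}x_s^{\varepsilon}|<+\infty,$$ and that there exists a constant $K$ such that $|\Delta x_t^{\varepsilon}|\le K|\Delta x_t|$ for any $t>0$ and $\varepsilon>0$. Then for any $f:\mathbb{R}\to\mathbb{R}$ of class $C^1$ and any $t>0$ the limit $$(\mathcal{X})\int_{0+}^t f(x_{s-})\,\mathrm{d}x_s:=\lim_{\varepsilon\to 0+}\int_{0+}^t f(x_{s-})\,\mathrm{d}x_s^{\varepsilon}$$ exists, and moreover $$F(x_t)-F(x_0)=(\mathcal{X})\int_{0+}^t f(x_{s-})\,\mathrm{d}x_s-\frac12\int_{0+}^t f'(x_{s-})\,\mathrm{d}\langle x\rangle_s+\sum_{0<s\le t}\left\{F(x_s)-F(x_{s-})-f(x_{s-})\Delta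 x_s\right\},$$ where $F$ is an antiderivative of $f$ and $\int_{0+}^t f'(x_{s-})\,\mathrm{d}\langle x\rangle_s$ is the usual Lebesgue–Stieltjes integral.
   Context: $\Delta x_s=x_s-x_{s-}$ for $s>0$. Integrals with respect to $x^{\varepsilon}$ are Lebesgue–Stieltjes integrals, and $|\mathrm{d}x^{\varepsilon}|$ denotes the total variation measure of $\mathrm{d}x^{\varepsilon}$. All integrals $\int_0^t$ and $\int_{0+}^t$ are taken over $(0,t]$. *)

theory Defs
  imports "HOL-Analysis.Analysis"
begin

text \<open>
  Paths on \<open>[0, \<infinity>)\<close> are functions \<open>real \<Rightarrow> real\<close>; no definition below depends on their values at
  negative times (left limits and jumps are only meaningful at times \<open>t > 0\<close>).
\<close>

definition cadlag :: "(real \<Rightarrow> real) \<Rightarrow> bool" where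
  "cadlag g \<longleftrightarrow> (\<forall>t\<ge>0. continuous (at_right t) g) \<and> (\<forall>t>0. \<exists>l. (g \<longlongrightarrow> l) (at_left t))"

definition left_lim :: "(real \<Rightarrow> real) \<Rightarrow> real \<Rightarrow> real" where
  "left_lim g t = Lim (at_left t) g"

definition jump :: "(real \<Rightarrow> real) \<Rightarrow> real \<Rightarrow> real" where
  "jump g t = g t - left_lim g t"

definition variation_sums :: "(real \<Rightarrow> real) \<Rightarrow> real \<Rightarrow> real set" where
  "variation_sums g t =
     {\<Sum>i<n. \<bar>g (p (Suc i)) - g (p i)\<bar> | n p. incseq p \<and> range p \<subseteq> {0..t}}"

definition finite_variation :: "(real \<Rightarrow> real) \<Rightarrow> bool" where
  "finite_variation g \<longleftrightarrow> (\<forall>t\<ge>0. bdd_above (variation_sums g t))"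

text \<open>
  The variation functions are extended by \<open>0\<close> to negative times, so the measures below do not charge
  \<open>(-\<infinity>, 0]\<close>.
\<close>

definition total_variation :: "(real \<Rightarrow> real) \<Rightarrow> real \<Rightarrow> real" where
  "total_variation g t = Sup (variation_sums g (max 0 t))"

definition positive_variation :: "(real \<Rightarrow> real) \<Rightarrow> real \<Rightarrow> real" where
  "positive_variation g t = (total_variation g t + (g (max 0 t) - g 0)) / 2"

definition negative_variation :: "(real \<Rightarrow> real) \<Rightarrow> real \<Rightarrow> real" where
  "negative_variation g t = (total_variation g t - (g (max 0 t) - g 0)) / 2"

text \<open>
  For \<open>g\<close> cadlag of finite variation the functions above are nondecreasing and right-continuous, and
  \<open>g = g 0 + positive_variation g - negative_variation g\<close> on \<open>[0, \<infinity>)\<close> is the Jordan decomposition,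
  so that the following are the measure \<open>|dg|\<close> and the Lebesgue--Stieltjes integral over \<open>(0, t]\<close>.
  For other \<open>g\<close> these definitions carry no meaning.
\<close>

definition variation_measure :: "(real \<Rightarrow> real) \<Rightarrow> real measure" where
  "variation_measure g = interval_measure (total_variation g)"

definition ls_integrable :: "(real \<Rightarrow> real) \<Rightarrow> real \<Rightarrow> (real \<Rightarrow> real) \<Rightarrow> bool" where
  "ls_integrable g t h \<longleftrightarrow> set_integrable (variation_measure g) {0<..t} h"

definition ls_integral :: "(real \<Rightarrow> real) \<Rightarrow> real \<Rightarrow> (real \<Rightarrow> real) \<Rightarrow> real" where
  "ls_integral g t h =
     (\<integral>s\<in>{0<..t}. h s \<partial>interval_measure (positive_variation g)) -
     (\<integral>s\<in>{0<..t}. h s \<partial>interval_measure (negative_variation g))"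

end

theory Submission
  imports Defs
begin

text \<open>
  Write \<open>y = X e\<close>, \<open>y\<^sub>-\<close> and \<open>x\<^sub>-\<close> for the left limits, \<open>\<Delta>\<close> for jumps and \<open>D\<close> for the derivative of \<open>f\<close>.  The
  proof compares \<open>F (y t) - F (y 0)\<close>, which converges to \<open>F (x t) - F (x 0)\<close>, with the integral of \<open>f (x\<^sub>-)\<close>
  against \<open>y\<close>.

  For a path of finite variation the change of variables formula, jumps included, says that
  \<open>F (y t) - F (y 0)\<close> is the integral of the divided difference \<open>(F y - F y\<^sub>-) / (y - y\<^sub>-)\<close> against \<open>y\<close>,
  read as \<open>f y\<close> where \<open>y = y\<^sub>-\<close>.  Indeed \<open>F\<close> telescopes along every grid, and divided differences over the
  cells converge boundedly when the grid is refined (\<open>chain_rule\<close>).  The divided difference minus \<open>f (x\<^sub>-)\<close> is then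
  split algebraically into three summands (\<open>integrand_decomposition\<close>):

  \<^item> \<open>D (x\<^sub>-) (y - x)\<close>.  Its integral converges to \<open>-1/2\<close> times the integral of \<open>D (x\<^sub>-)\<close> against \<open>Q\<close>.  For
    step functions in place of \<open>D (x\<^sub>-)\<close> this is the definition of \<open>Q\<close>, and the uniform bound on the masses of
    \<open>\<bar>x - y\<bar> \<bar>dy\<bar>\<close> extends it to uniform limits of step functions (\<open>weighted_error_limit\<close>).  The same bound
    shows that \<open>Q\<close> has finite variation, so that the limit makes sense.

  \<^item> \<open>f (y\<^sub>-) - f (x\<^sub>-) - D (x\<^sub>-) (y\<^sub>- - x\<^sub>-)\<close>.  This is small compared with \<open>\<bar>y\<^sub>- - x\<^sub>-\<bar>\<close>, whose integral
    against \<open>\<bar>dy\<bar>\<close> stays bounded (\<open>taylor_error_limit\<close>).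

  \<^item> A remainder that vanishes except at the countably many jumps of \<open>x\<close>.  Its integral is the sum of
    \<open>F y - F y\<^sub>- - f (y\<^sub>-) \<Delta>y - D (x\<^sub>-) (\<Delta>y - \<Delta>x) \<Delta>y\<close>, dominated by a multiple of \<open>(\<Delta>x)\<^sup>2\<close> because
    \<open>\<bar>\<Delta>y\<bar> \<le> K \<bar>\<Delta>x\<bar>\<close>, and it converges to the jump sum of the formula (\<open>jump_error_limit\<close>).

  That \<open>\<bar>dy\<bar>\<close> has atoms of mass exactly \<open>\<bar>\<Delta>y\<bar>\<close> (\<open>total_variation_jump\<close>) is what connects integrals with
  sums over jumps.
\<close>

section \<open>Total variation of a path\<close>

definition partition_sum :: "(real \<Rightarrow> real) \<Rightarrow> (nat \<Rightarrow> real) \<Rightarrow> nat \<Rightarrow> real" where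
  "partition_sum g p n = (\<Sum>i<n. \<bar>g (p (Suc i)) - g (p i)\<bar>)"

lemma variation_sums_altdef:
  "variation_sums g t = {partition_sum g p n | n p. incseq p \<and> range p \<subseteq> {0..t}}"
  unfolding variation_sums_def partition_sum_def ..

text \<open>Cutting at \<open>c\<close> splits a partition without inserting a point: below \<open>c\<close> the first cut partition moves
  and the second rests at \<open>c\<close>, above \<open>c\<close> it is the other way round, and the triangle inequality is used
  only for the single step that crosses \<open>c\<close>.\<close>

lemma partition_sum_split:
  assumes "incseq p"
  shows "partition_sum g p n
    \<le> partition_sum g (\<lambda>i. min (p i) c) n + partition_sum g (\<lambda>i. max (p i) c) n"
  unfolding partition_sum_def sum.distrib[symmetric]
proof (rule sum_mono)
  fix i
  have "p i \<le> p (Suc i)" using assms by (simp add: incseq_SucD)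
  then consider "p (Suc i) \<le> c" | "c \<le> p i" | "p i \<le> c" "c \<le> p (Suc i)" by linarith
  then show "\<bar>g (p (Suc i)) - g (p i)\<bar>
      \<le> \<bar>g (min (p (Suc i)) c) - g (min (p i) c)\<bar> + \<bar>g (max (p (Suc i)) c) - g (max (p i) c)\<bar>"
    by cases (use \<open>p i \<le> p (Suc i)\<close> in \<open>auto simp: min_def max_def\<close>)
qed

lemma partition_sum_two_points:
  assumes "incseq p" "\<And>i. p i = a \<or> p i = b" "a \<le> b"
  shows "partition_sum g p n \<le> \<bar>g b - g a\<bar>"
proof -
  \<comment> \<open>The partition passes from \<open>a\<close> to \<open>b\<close> at most once, and \<open>k\<close> records whether it has done so.\<close>
  define k where "k i = (if p i = a then 0 else \<bar>g b - g a\<bar>)" for i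
  have "partition_sum g p n \<le> (\<Sum>i<n. k (Suc i) - k i)"
    unfolding partition_sum_def
  proof (rule sum_mono)
    fix i
    have "p i \<le> p (Suc i)" using assms by (simp add: incseq_SucD)
    then show "\<bar>g (p (Suc i)) - g (p i)\<bar> \<le> k (Suc i) - k i"
      using assms(2)[of i] assms(2)[of "Suc i"] assms(3) by (auto simp: k_def)
  qed
  also have "\<dots> = k n - k 0" by (rule sum_lessThan_telescope)
  also have "\<dots> \<le> \<bar>g b - g a\<bar>" by (auto simp: k_def)
  finally show ?thesis .
qed

lemma total_variation_upper:
  assumes "finite_variation g" "0 \<le> t" "incseq p" "range p \<subseteq> {0..t}"
  shows "partition_sum g p n \<le> total_variation g t"
  unfolding total_variation_def
proof (rule cSup_upper)
  show "partition_sum g p n \<in> variation_sums g (max 0 t)"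
    using assms by (auto simp: variation_sums_altdef)
  show "bdd_above (variation_sums g (max 0 t))"
    using assms by (simp add: finite_variation_def)
qed

lemma variation_sums_nonempty: "0 \<le> t \<Longrightarrow> 0 \<in> variation_sums g t"
  unfolding variation_sums_def
  by (auto intro!: exI[of _ "0::nat"] exI[of _ "\<lambda>_. 0::real"] simp: incseq_def)

lemma total_variation_least:
  assumes "0 \<le> t" "\<And>p n. incseq p \<Longrightarrow> range p \<subseteq> {0..t} \<Longrightarrow> partition_sum g p n \<le> B"
  shows "total_variation g t \<le> B"
  unfolding total_variation_def
proof (rule cSup_least)
  show "variation_sums g (max 0 t) \<noteq> {}" using variation_sums_nonempty[of "max 0 t" g] by auto
  show "\<And>v. v \<in> variation_sums g (max 0 t) \<Longrightarrow> v \<le> B"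
    using assms by (auto simp: variation_sums_altdef)
qed

lemma total_variation_nonpos: "t \<le> 0 \<Longrightarrow> total_variation g t = 0"
proof -
  assume "t \<le> 0"
  have "variation_sums g 0 = {0}"
  proof -
    have "partition_sum g p n = 0" if "range p \<subseteq> {0..0}" for p n
    proof -
      have "p i = 0" for i using that by auto
      then show ?thesis by (simp add: partition_sum_def)
    qed
    then have "variation_sums g 0 \<subseteq> {0}" by (auto simp: variation_sums_altdef)
    then show ?thesis using variation_sums_nonempty[of 0 g] by blast
  qed
  then show ?thesis using \<open>t \<le> 0\<close> by (simp add: total_variation_def max_def)
qed

text \<open>Appending a partition of \<open>[a, b]\<close> to a partition of \<open>[0, a]\<close> gives a partition of \<open>[0, b]\<close>.
  Together with the converse estimate below this makes increments of the variation function suprema of partition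
  sums, and no separate notion of variation on an interval is needed.\<close>

lemma partition_sum_le_total_variation_diff:
  assumes "finite_variation g" "0 \<le> a" "a \<le> b" "incseq q" "range q \<subseteq> {a..b}"
  shows "partition_sum g q m \<le> total_variation g b - total_variation g a"
proof -
  have "total_variation g a \<le> total_variation g b - partition_sum g q m"
  proof (rule total_variation_least[OF assms(2)])
    fix p n assume p: "incseq p" "range p \<subseteq> {0..a}"
    define r where "r i = (if i \<le> n then p i else q (i - Suc n))" for i
    have pq: "p i \<le> a" "0 \<le> p i" "a \<le> q i" "q i \<le> b" for i
      using subsetD[OF p(2) rangeI, of i] subsetD[OF assms(5) rangeI, of i] by auto
    have "incseq r"
    proof (rule incseq_SucI)
      fix i show "r i \<le> r (Suc i)"
        using p(1) assms(4) pq(1)[of i] pq(3)[of 0]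
        by (auto simp: r_def incseq_def)
    qed
    moreover have "range r \<subseteq> {0..b}"
    proof -
      have "0 \<le> r i \<and> r i \<le> b" for i
        using pq[of i] pq[of "i - Suc n"] assms(2,3) by (auto simp: r_def)
      then show ?thesis by auto
    qed
    ultimately have "partition_sum g r (Suc n + m) \<le> total_variation g b"
      using assms by (intro total_variation_upper) auto
    moreover have "partition_sum g r (Suc n + m) = partition_sum g p n + \<bar>g (q 0) - g (p n)\<bar> + partition_sum g q m"
    proof -
      have split: "(\<Sum>i<Suc n + m. h i) = (\<Sum>i<n. h i) + h n + (\<Sum>i<m. h (Suc n + i))" for h :: "nat \<Rightarrow> real"
        by (induction m) auto
      show ?thesis
        unfolding partition_sum_def split
        by (auto simp: r_def intro!: arg_cong2[of _ _ _ _ "(+)"] sum.cong)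
    qed
    ultimately show "partition_sum g p n \<le> total_variation g b - partition_sum g q m"
      by linarith
  qed
  then show ?thesis by linarith
qed

lemma abs_increment_le_total_variation_diff:
  assumes "finite_variation g" "0 \<le> a" "a \<le> b"
  shows "\<bar>g b - g a\<bar> \<le> total_variation g b - total_variation g a"
proof -
  have "partition_sum g (\<lambda>i. if i = 0 then a else b) 1 \<le> total_variation g b - total_variation g a"
    using assms by (intro partition_sum_le_total_variation_diff) (auto simp: incseq_def)
  then show ?thesis by (simp add: partition_sum_def)
qed

lemma total_variation_mono:
  assumes "finite_variation g" "a \<le> b"
  shows "total_variation g a \<le> total_variation g b"
proof (cases "0 \<le> a")
  case True
  then show ?thesis using abs_increment_le_total_variation_diff[OF assms(1) True assms(2)] by linarith
next
  case False
  show ?thesis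
  proof (cases "0 \<le> b")
    case True
    then show ?thesis
      using abs_increment_le_total_variation_diff[OF assms(1) order_refl True]
        total_variation_nonpos[of a g] total_variation_nonpos[of 0 g] False by linarith
  qed (use False total_variation_nonpos[of _ g] in auto)
qed

lemma total_variation_diff_approx:
  assumes "finite_variation g" "0 \<le> a" "a \<le> b" "0 < e"
  obtains p n where "incseq p" "range p \<subseteq> {a..b}"
    "total_variation g b - total_variation g a - e < partition_sum g p n"
proof -
  have "total_variation g b - e < Sup (variation_sums g (max 0 b))"
    using assms by (simp add: total_variation_def)
  then obtain v where v: "v \<in> variation_sums g b" "total_variation g b - e < v"
    using less_cSupE[of "total_variation g b - e" "variation_sums g b"]
      variation_sums_nonempty[of b g] assms by auto
  then obtain p n where p: "incseq p" "range p \<subseteq> {0..b}" "total_variation g b - e < partition_sum g p n"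
    by (auto simp: variation_sums_altdef)
  have inc: "incseq (\<lambda>i. min (p i) a)" "incseq (\<lambda>i. max (p i) a)"
    using p(1) unfolding incseq_def by (blast intro: min.mono max.mono order_refl)+
  have "partition_sum g (\<lambda>i. min (p i) a) n \<le> total_variation g a"
    using assms p(2) by (intro total_variation_upper inc) (auto simp: subset_iff image_iff min_le_iff_disj le_max_iff_disj)
  then have "total_variation g b - total_variation g a - e < partition_sum g (\<lambda>i. max (p i) a) n"
    using partition_sum_split[OF p(1), of g n a] p(3) by linarith
  moreover have "range (\<lambda>i. max (p i) a) \<subseteq> {a..b}"
    using p(2) assms by (auto simp: subset_iff image_iff)
  ultimately show ?thesis using inc(2) that by blast
qed

lemma cadlag_right: "cadlag g \<Longrightarrow> 0 \<le> t \<Longrightarrow> (g \<longlongrightarrow> g t) (at_right t)"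
  by (simp add: cadlag_def continuous_within)

lemma cadlag_left: "cadlag g \<Longrightarrow> 0 < t \<Longrightarrow> (g \<longlongrightarrow> left_lim g t) (at_left t)"
  unfolding cadlag_def left_lim_def by (metis tendsto_Lim trivial_limit_at_left_real)

text \<open>
  A finite partition has no point strictly between a time \<open>s\<close> and the times close enough to it on
  one side.  A partition that nearly attains the variation therefore sees a single increment of \<open>g\<close>
  next to \<open>s\<close>, and this increment is close to zero on the right of \<open>s\<close> and to the jump on the left.
  This gives both the right continuity of the variation and the size of its jumps.
\<close>

lemma total_variation_right_continuous:
  assumes "finite_variation g" "cadlag g"
  shows "continuous (at_right s) (total_variation g)"
proof (cases "0 \<le> s")
  case False
  have "(total_variation g \<longlongrightarrow> 0) (at_right s)"
    by (rule tendsto_eventually)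
       (use False in \<open>auto simp: eventually_at_right_field intro!: exI[of _ 0] total_variation_nonpos\<close>)
  then show ?thesis using False total_variation_nonpos[of s g] by (simp add: continuous_within)
next
  case s: True
  have "\<forall>\<^sub>F u in at_right s. \<bar>total_variation g u - total_variation g s\<bar> < e" if "0 < e" for e
  proof -
    obtain p n where p: "incseq p" "range p \<subseteq> {s..s+1}"
      "total_variation g (s+1) - total_variation g s - e/2 < partition_sum g p n"
      using total_variation_diff_approx[OF assms(1) s, of "s+1" "e/2"] \<open>0 < e\<close> by auto
    have "\<forall>\<^sub>F u in at_right s. \<bar>g u - g s\<bar> < e/2"
      using tendstoD[OF cadlag_right[OF assms(2) s], of "e/2"] \<open>0 < e\<close> by (simp add: dist_real_def)
    moreover have "\<forall>\<^sub>F u in at_right s. s < u \<and> u \<le> s+1"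
      by (auto simp: eventually_at_right_field intro!: exI[of _ "s+1"])
    moreover have "\<forall>\<^sub>F u in at_right s. \<forall>i\<le>n. p i = s \<or> u \<le> p i"
    proof -
      have "\<forall>\<^sub>F u in at_right s. \<forall>i\<in>{..n}. p i = s \<or> u \<le> p i"
      proof (rule eventually_ball_finite)
        show "\<forall>i\<in>{..n}. \<forall>\<^sub>F u in at_right s. p i = s \<or> u \<le> p i"
        proof
          fix i
          have "s \<le> p i" using subsetD[OF p(2) rangeI, of i] by auto
          then show "\<forall>\<^sub>F u in at_right s. p i = s \<or> u \<le> p i"
            by (cases "p i = s") (auto simp: eventually_at_right_field intro!: exI[of _ "p i"])
        qed
      qed simp
      then show ?thesis by (simp only: Ball_def atMost_iff)
    qed
    ultimately show ?thesis
    proof eventually_elim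
      case (elim u)
      then have u: "s < u" "u \<le> s+1" "\<bar>g u - g s\<bar> < e/2" "\<And>i. i \<le> n \<Longrightarrow> p i = s \<or> u \<le> p i" by auto
      \<comment> \<open>The gap between \<open>s\<close> and \<open>u\<close> is free only of the first \<open>n + 1\<close> points, so \<open>p\<close> is frozen after index \<open>n\<close>.\<close>
      have "partition_sum g (\<lambda>i. min (p i) u) n = partition_sum g (\<lambda>i. min (p (min i n)) u) n"
        unfolding partition_sum_def by (intro sum.cong) auto
      also have "\<dots> \<le> \<bar>g u - g s\<bar>"
      proof (rule partition_sum_two_points)
        show "incseq (\<lambda>i. min (p (min i n)) u)"
          using p(1) unfolding incseq_def by (blast intro: min.mono order_refl)
        show "min (p (min i n)) u = s \<or> min (p (min i n)) u = u" for i
          using u(4)[of "min i n"] u(1) by auto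
      qed (use u in auto)
      finally have 1: "partition_sum g (\<lambda>i. min (p i) u) n < e/2" using u by linarith
      have 2: "partition_sum g (\<lambda>i. max (p i) u) n \<le> total_variation g (s+1) - total_variation g u"
      proof (rule partition_sum_le_total_variation_diff[OF assms(1)])
        show "incseq (\<lambda>i. max (p i) u)" using p(1) unfolding incseq_def by (blast intro: max.mono order_refl)
        show "range (\<lambda>i. max (p i) u) \<subseteq> {u..s+1}" using p(2) u by auto
      qed (use s u in auto)
      have "total_variation g s \<le> total_variation g u"
        using u by (intro total_variation_mono assms) auto
      then show ?case using partition_sum_split[OF p(1), of g n u] p(3) 1 2 by linarith
    qed
  qed
  then show ?thesis by (auto simp: continuous_within tendsto_iff dist_real_def)
qed

lemma total_variation_jump:
  assumes "finite_variation g" "cadlag g" "0 < s"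
  shows "((\<lambda>u. total_variation g s - total_variation g u) \<longlongrightarrow> \<bar>jump g s\<bar>) (at_left s)"
proof -
  have conv: "((\<lambda>u. \<bar>g s - g u\<bar>) \<longlongrightarrow> \<bar>jump g s\<bar>) (at_left s)"
    unfolding jump_def by (intro tendsto_intros cadlag_left assms)
  have pos: "\<forall>\<^sub>F u in at_left s. 0 < u \<and> u < s"
    using assms(3) by (auto simp: eventually_at_left_field intro!: exI[of _ 0])
  have "\<forall>\<^sub>F u in at_left s. \<bar>total_variation g s - total_variation g u - \<bar>jump g s\<bar>\<bar> < e" if "0 < e" for e
  proof -
    obtain p n where p: "incseq p" "range p \<subseteq> {0..s}"
      "total_variation g s - total_variation g 0 - e/2 < partition_sum g p n"
      using total_variation_diff_approx[OF assms(1) order_refl, of s "e/2"] \<open>0 < e\<close> assms(3) by auto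
    have "\<forall>\<^sub>F u in at_left s. \<bar>\<bar>g s - g u\<bar> - \<bar>jump g s\<bar>\<bar> < e/2"
      using tendstoD[OF conv, of "e/2"] \<open>0 < e\<close> by (simp add: dist_real_def)
    moreover note pos
    moreover have "\<forall>\<^sub>F u in at_left s. \<forall>i\<le>n. p i = s \<or> p i \<le> u"
    proof -
      have "\<forall>\<^sub>F u in at_left s. \<forall>i\<in>{..n}. p i = s \<or> p i \<le> u"
      proof (rule eventually_ball_finite)
        show "\<forall>i\<in>{..n}. \<forall>\<^sub>F u in at_left s. p i = s \<or> p i \<le> u"
        proof
          fix i
          have "p i \<le> s" using subsetD[OF p(2) rangeI, of i] by auto
          then show "\<forall>\<^sub>F u in at_left s. p i = s \<or> p i \<le> u"
            by (cases "p i = s") (auto simp: eventually_at_left_field intro!: exI[of _ "p i"])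
        qed
      qed simp
      then show ?thesis by (simp only: Ball_def atMost_iff)
    qed
    ultimately show ?thesis
    proof eventually_elim
      case (elim u)
      then have u: "0 < u" "u < s" "\<bar>\<bar>g s - g u\<bar> - \<bar>jump g s\<bar>\<bar> < e/2"
        "\<And>i. i \<le> n \<Longrightarrow> p i = s \<or> p i \<le> u" by auto
      \<comment> \<open>The gap between \<open>s\<close> and \<open>u\<close> is free only of the first \<open>n + 1\<close> points, so \<open>p\<close> is frozen after index \<open>n\<close>.\<close>
      have "partition_sum g (\<lambda>i. max (p i) u) n = partition_sum g (\<lambda>i. max (p (min i n)) u) n"
        unfolding partition_sum_def by (intro sum.cong) auto
      also have "\<dots> \<le> \<bar>g s - g u\<bar>"
      proof (rule partition_sum_two_points)
        show "incseq (\<lambda>i. max (p (min i n)) u)"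
          using p(1) unfolding incseq_def by (blast intro: max.mono order_refl min.mono)
        show "max (p (min i n)) u = u \<or> max (p (min i n)) u = s" for i
          using u(4)[of "min i n"] u(2) by auto
      qed (use u in auto)
      finally have 1: "partition_sum g (\<lambda>i. max (p i) u) n \<le> \<bar>g s - g u\<bar>" .
      have 2: "partition_sum g (\<lambda>i. min (p i) u) n \<le> total_variation g u"
      proof (rule total_variation_upper[OF assms(1)])
        show "incseq (\<lambda>i. min (p i) u)" using p(1) unfolding incseq_def by (blast intro: min.mono order_refl)
        show "range (\<lambda>i. min (p i) u) \<subseteq> {0..u}" using p(2) u by auto
      qed (use u in auto)
      have "\<bar>g s - g u\<bar> \<le> total_variation g s - total_variation g u"
        using u by (intro abs_increment_le_total_variation_diff assms) auto
      then show ?case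
        using partition_sum_split[OF p(1), of g n u] p(3) 1 2 u total_variation_nonpos[of 0 g] by linarith
    qed
  qed
  then show ?thesis by (auto simp: tendsto_iff dist_real_def)
qed

section \<open>Lebesgue--Stieltjes integrals\<close>

text \<open>The set function on the right is a measure that agrees with the left side on half-open intervals,
  and these intervals are stable under intersection and generate the Borel sets.  It is needed to
  split the variation measure into the two measures of the Jordan decomposition.\<close>

lemma interval_measure_sum_measure:
  fixes F G :: "real \<Rightarrow> real"
  assumes F: "\<And>x y. x \<le> y \<Longrightarrow> F x \<le> F y" "\<And>a. continuous (at_right a) F"
    and G: "\<And>x y. x \<le> y \<Longrightarrow> G x \<le> G y" "\<And>a. continuous (at_right a) G"
    and A: "A \<in> sets borel"
  shows "emeasure (interval_measure (\<lambda>x. F x + G x)) A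
    = emeasure (interval_measure F) A + emeasure (interval_measure G) A"
proof -
  have FG: "\<And>x y. x \<le> y \<Longrightarrow> F x + G x \<le> F y + G y" "\<And>a. continuous (at_right a) (\<lambda>x. F x + G x)"
    by (intro add_mono continuous_add F G; assumption)+
  define m where "m A = emeasure (interval_measure F) A + emeasure (interval_measure G) A" for A
  define M where "M = measure_of UNIV (sets borel) m"
  have M: "emeasure M A = m A" if "A \<in> sets borel" for A
    unfolding M_def
  proof (rule emeasure_measure_of_sigma)
    show "sigma_algebra UNIV (sets (borel :: real measure))"
      using sets.sigma_algebra_axioms[of "borel :: real measure"] by simp
    show "positive (sets borel) m" by (simp add: positive_def m_def)
    show "countably_additive (sets borel) m"
      unfolding countably_additive_def m_def
    proof (intro allI impI)
      fix A :: "nat \<Rightarrow> real set" assume A: "range A \<subseteq> sets borel" "disjoint_family A"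
      then show "(\<Sum>i. emeasure (interval_measure F) (A i) + emeasure (interval_measure G) (A i))
          = emeasure (interval_measure F) (\<Union>(range A)) + emeasure (interval_measure G) (\<Union>(range A))"
        by (simp add: suminf_add[symmetric] suminf_emeasure)
    qed
  qed fact
  have setsM: "sets M = sets borel"
    using sets.sigma_sets_eq[of "borel :: real measure"] by (simp add: M_def)
  have "interval_measure (\<lambda>x. F x + G x) = M"
  proof (rule measure_eqI_generator_eq[where \<Omega> = UNIV and E = "range (\<lambda>(a, b). {a<..b::real})"
        and A = "\<lambda>n. {- real n <.. real n}"])
    show "Int_stable (range (\<lambda>(a, b). {a<..b::real}))"
    proof (rule Int_stableI, clarify)
      fix a b c d :: real
      show "{a<..b} \<inter> {c<..d} \<in> range (\<lambda>(a, b). {a<..b})"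
        by (auto intro!: image_eqI[of _ _ "(max a c, min b d)"])
    qed
    show "emeasure (interval_measure (\<lambda>x. F x + G x)) X = emeasure M X"
      if X: "X \<in> range (\<lambda>(a, b). {a<..b})" for X
    proof -
      obtain a b where ab: "X = {a<..b}" using X by auto
      have "emeasure (interval_measure (\<lambda>x. F x + G x)) {a<..b} = (if a \<le> b then ennreal (F b + G b - (F a + G a)) else 0)"
        using emeasure_interval_measure_Ioc_eq[of "\<lambda>x. F x + G x", OF FG] by simp
      moreover have "X \<in> sets borel" using ab by simp
      ultimately show ?thesis
        using emeasure_interval_measure_Ioc_eq[of F a b, OF F] emeasure_interval_measure_Ioc_eq[of G a b, OF G]
          F(1)[of a b] G(1)[of a b]
        by (auto simp: M ab m_def ennreal_plus[symmetric] algebra_simps simp del: ennreal_plus)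
    qed
    show "sets (interval_measure (\<lambda>x. F x + G x)) = sigma_sets UNIV (range (\<lambda>(a, b). {a<..b::real}))"
      by (simp add: borel_sigma_sets_Ioc)
    show "sets M = sigma_sets UNIV (range (\<lambda>(a, b). {a<..b::real}))"
      unfolding setsM by (subst borel_sigma_sets_Ioc) simp
    show "(\<Union>i. {- real i <.. real i}) = UNIV"
    proof (intro set_eqI iffI UNIV_I)
      fix x :: real
      obtain n where "\<bar>x\<bar> < real n" using reals_Archimedean2 by blast
      then show "x \<in> (\<Union>i. {- real i <.. real i})" by (auto intro!: exI[of _ n])
    qed
    show "emeasure (interval_measure (\<lambda>x. F x + G x)) {- real i <.. real i} \<noteq> \<infinity>" for i
    proof -
      have "emeasure (interval_measure (\<lambda>x. F x + G x)) {- real i<..real i}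
          = (if - real i \<le> real i then ennreal (F (real i) + G (real i) - (F (- real i) + G (- real i))) else 0)"
        using emeasure_interval_measure_Ioc_eq[of "\<lambda>x. F x + G x", OF FG] by simp
      then show ?thesis by auto
    qed
  qed auto
  then show ?thesis using M[OF A] by (simp add: m_def)
qed

lemma nn_integral_interval_measure_sum:
  fixes F G :: "real \<Rightarrow> real"
  assumes F: "\<And>x y. x \<le> y \<Longrightarrow> F x \<le> F y" "\<And>a. continuous (at_right a) F"
    and G: "\<And>x y. x \<le> y \<Longrightarrow> G x \<le> G y" "\<And>a. continuous (at_right a) G"
    and h: "h \<in> borel_measurable borel"
  shows "(\<integral>\<^sup>+s. h s \<partial>interval_measure (\<lambda>x. F x + G x))
    = (\<integral>\<^sup>+s. h s \<partial>interval_measure F) + (\<integral>\<^sup>+s. h s \<partial>interval_measure G)"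
  using h
proof (induction rule: borel_measurable_induct)
  case (cong f g)
  then show ?case by (simp cong: nn_integral_cong)
next
  case (set A)
  then show ?case by (simp add: interval_measure_sum_measure[OF F G])
next
  case (mult u c)
  then show ?case by (simp add: nn_integral_cmult distrib_left)
next
  case (add u v)
  then show ?case by (simp add: nn_integral_add algebra_simps)
next
  case (seq U)
  have inc: "incseq (\<lambda>i. \<integral>\<^sup>+s. U i s \<partial>M)" for M :: "real measure"
    using seq by (auto simp: incseq_def le_fun_def intro!: nn_integral_mono)
  have "(\<integral>\<^sup>+s. (SUP i. U i) s \<partial>interval_measure K) = (SUP i. \<integral>\<^sup>+s. U i s \<partial>interval_measure K)" for K
    using seq nn_integral_monotone_convergence_SUP[of U "interval_measure K"]
    by (simp add: SUP_apply image_image)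
  then show ?case using seq.IH ennreal_SUP_add[OF inc inc] by simp
qed

text \<open>An atomic integral is a sum over the atoms: on a countable set every measure has a density with
  respect to counting measure.\<close>

lemma has_sum_integral_countable_support:
  fixes h :: "real \<Rightarrow> real"
  assumes sets: "sets M = sets borel" and h: "integrable M h"
    and J: "countable J" "\<And>s. s \<notin> J \<Longrightarrow> h s = 0" and fin: "\<And>s. s \<in> J \<Longrightarrow> emeasure M {s} < \<infinity>"
  shows "((\<lambda>s. h s * measure M {s}) has_sum (\<integral>s. h s \<partial>M)) J"
proof -
  have Jb: "B \<in> sets M" if "B \<subseteq> J" for B
    using sets.countable[of B M] that J(1) countable_subset[of B J] by (auto simp: sets)
  have sp: "space M = UNIV" using sets sets_eq_imp_space_eq by fastforce
  define R where "R = restrict_space M J"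
  define C where "C = density (count_space J) (\<lambda>s. ennreal (measure M {s}))"
  have "R = C"
  proof (rule measure_eqI_countable)
    show "sets R = Pow J"
    proof -
      have "sets R = (\<inter>) J ` sets M" by (simp add: R_def sets_restrict_space)
      also have "\<dots> = Pow J"
      proof (intro equalityI subsetI)
        fix B assume "B \<in> Pow J"
        then show "B \<in> (\<inter>) J ` sets M" using Jb[of B] by (intro image_eqI[of _ _ B]) auto
      qed auto
      finally show ?thesis .
    qed
    show "sets C = Pow J" by (simp add: C_def)
    show "countable J" by fact
    fix a assume a: "a \<in> J"
    have "emeasure R {a} = emeasure M {a}"
      unfolding R_def using a Jb[of J] sp by (intro emeasure_restrict_space) auto
    also have "\<dots> = ennreal (measure M {a})"
      using fin[OF a] by (simp add: emeasure_eq_ennreal_measure)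
    also have "\<dots> = emeasure C {a}"
      using a nn_integral_indicator_singleton[of a "count_space J" "\<lambda>s. ennreal (measure M {s})"]
      by (simp add: C_def emeasure_density del: indicator_simps)
    finally show "emeasure R {a} = emeasure C {a}" .
  qed
  have ind: "(\<lambda>x. indicator J x *\<^sub>R h x) = h"
    using J(2) by (auto simp: indicator_def fun_eq_iff)
  have "integrable R h" "(\<integral>s. h s \<partial>R) = (\<integral>s. h s \<partial>M)"
    using h ind Jb[of J] sp by (simp_all add: R_def integrable_restrict_space integral_restrict_space)
  then have "integrable (count_space J) (\<lambda>s. measure M {s} *\<^sub>R h s)"
    "(\<integral>s. measure M {s} *\<^sub>R h s \<partial>count_space J) = (\<integral>s. h s \<partial>M)"
    unfolding \<open>R = C\<close> C_def by (simp_all add: integrable_density integral_density)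
  then have 1: "Infinite_Set_Sum.abs_summable_on (\<lambda>s. h s * measure M {s}) J"
    and 2: "infsetsum (\<lambda>s. h s * measure M {s}) J = (\<integral>s. h s \<partial>M)"
    by (simp_all add: Infinite_Set_Sum.abs_summable_on_def infsetsum_def mult.commute)
  have "(\<lambda>s. h s * measure M {s}) summable_on J"
    using 1 abs_summable_equivalent abs_summable_summable by blast
  then show ?thesis using infsetsum_infsum[OF 1] 2 by (simp add: has_sum_iff)
qed

text \<open>The integral over the whole line.  Integrals over \<open>(0, t]\<close> are obtained from it by putting the
  indicator function into the integrand, so that integrands over different intervals can be added.\<close>

definition stieltjes :: "(real \<Rightarrow> real) \<Rightarrow> (real \<Rightarrow> real) \<Rightarrow> real" where
  "stieltjes g h = (\<integral>s. h s \<partial>interval_measure (positive_variation g)) -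
     (\<integral>s. h s \<partial>interval_measure (negative_variation g))"

lemma ls_integral_eq_stieltjes:
  "ls_integral g t h = stieltjes g (\<lambda>s. indicator {0<..t} s * h s)"
  by (simp add: ls_integral_def stieltjes_def set_lebesgue_integral_def)

lemma ls_integrable_iff:
  "ls_integrable g t h \<longleftrightarrow> integrable (variation_measure g) (\<lambda>s. indicator {0<..t} s * h s)"
  by (simp add: ls_integrable_def set_integrable_def)

lemma sets_variation_measure [simp, measurable_cong]: "sets (variation_measure g) = sets borel"
  by (simp add: variation_measure_def)

lemma space_variation_measure [simp]: "space (variation_measure g) = UNIV"
  by (simp add: variation_measure_def)

text \<open>The intervals \<open>(s - 1 / n, s]\<close> decrease to \<open>{s}\<close>, so an atom is the jump of the distribution function.\<close>

lemma interval_measure_singleton: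
  fixes F :: "real \<Rightarrow> real"
  assumes F: "\<And>x y. x \<le> y \<Longrightarrow> F x \<le> F y" "\<And>a. continuous (at_right a) F"
    and l: "((\<lambda>u. F s - F u) \<longlongrightarrow> d) (at_left s)"
  shows "emeasure (interval_measure F) {s} = ennreal d \<and> measure (interval_measure F) {s} = d"
proof -
  have seq: "filterlim (\<lambda>n. s - 1 / real (Suc n)) (at_left s) sequentially"
    unfolding filterlim_at
    using tendsto_diff[OF tendsto_const[of s] LIMSEQ_inverse_real_of_nat]
    by (simp add: inverse_eq_divide)
  have "(\<lambda>n. emeasure (interval_measure F) {s - 1 / real (Suc n)<..s})
      \<longlonglongrightarrow> emeasure (interval_measure F) (\<Inter>n. {s - 1 / real (Suc n)<..s})"
  proof (rule Lim_emeasure_decseq)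
    show "decseq (\<lambda>n. {s - 1 / real (Suc n)<..s})"
    proof (rule decseq_SucI, rule subsetI)
      fix n x assume "x \<in> {s - 1 / real (Suc (Suc n))<..s}"
      moreover have "1 / real (Suc (Suc n)) \<le> 1 / real (Suc n)" by (simp add: divide_simps)
      ultimately show "x \<in> {s - 1 / real (Suc n)<..s}" by auto
    qed
  qed (auto simp: emeasure_interval_measure_Ioc[OF _ F])
  moreover have "(\<Inter>n. {s - 1 / real (Suc n)<..s}) = {s}"
  proof -
    have "x = s" if "\<And>n. s - 1 / real (Suc n) < x \<and> x \<le> s" for x
    proof (rule ccontr)
      assume "x \<noteq> s"
      then have "0 < s - x" using that[of 0] by auto
      then obtain n where "inverse (real (Suc n)) < s - x" using reals_Archimedean by blast
      then show False using that[of n] by (simp add: inverse_eq_divide)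
    qed
    then show ?thesis by auto
  qed
  moreover have "(\<lambda>n. emeasure (interval_measure F) {s - 1 / real (Suc n)<..s}) \<longlonglongrightarrow> ennreal d"
    using tendsto_ennrealI[OF filterlim_compose[OF l seq]]
    by (simp add: emeasure_interval_measure_Ioc[OF _ F])
  ultimately have "emeasure (interval_measure F) {s} = ennreal d"
    using LIMSEQ_unique by metis
  moreover have "0 \<le> d"
    by (rule tendsto_lowerbound[OF l])
       (auto simp: eventually_at_left_field F intro!: exI[of _ "s - 1"])
  ultimately show ?thesis by (simp add: measure_def)
qed

locale fv_path =
  fixes g :: "real \<Rightarrow> real"
  assumes cadlag: "cadlag g" and fv: "finite_variation g"
begin

abbreviation "V \<equiv> total_variation g"
abbreviation "P \<equiv> positive_variation g"
abbreviation "N \<equiv> negative_variation g"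

lemma V_mono: "a \<le> b \<Longrightarrow> V a \<le> V b" by (rule total_variation_mono[OF fv])

lemma V_right: "continuous (at_right a) V" by (rule total_variation_right_continuous[OF fv cadlag])

lemma stopped_right: "continuous (at_right a) (\<lambda>t. g (max 0 t))"
proof (cases "0 \<le> a")
  case True
  have "((\<lambda>t. g (max 0 t)) \<longlongrightarrow> g a) (at_right a)"
    using cadlag_right[OF cadlag True]
    by (rule Lim_transform_eventually)
       (use True in \<open>auto simp: eventually_at_right_field max_def intro!: exI[of _ "a+1"]\<close>)
  then show ?thesis using True by (simp add: continuous_within max_def)
next
  case False
  have "((\<lambda>t. g (max 0 t)) \<longlongrightarrow> g 0) (at_right a)"
    by (rule tendsto_eventually)
       (use False in \<open>auto simp: eventually_at_right_field max_def intro!: exI[of _ 0]\<close>)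
  then show ?thesis using False by (simp add: continuous_within max_def)
qed

lemma increment_le: "a \<le> b \<Longrightarrow> \<bar>g (max 0 b) - g (max 0 a)\<bar> \<le> V b - V a"
proof -
  assume "a \<le> b"
  then have "\<bar>g (max 0 b) - g (max 0 a)\<bar> \<le> V (max 0 b) - V (max 0 a)"
    by (intro abs_increment_le_total_variation_diff fv) auto
  moreover have "V (max 0 c) = V c" for c by (simp add: total_variation_def)
  ultimately show ?thesis by simp
qed

lemma P_mono: "a \<le> b \<Longrightarrow> P a \<le> P b"
  using increment_le[of a b] by (simp add: positive_variation_def divide_simps)

lemma N_mono: "a \<le> b \<Longrightarrow> N a \<le> N b"
  using increment_le[of a b] by (simp add: negative_variation_def divide_simps)

lemma P_right: "continuous (at_right a) P"
  unfolding positive_variation_def by (intro continuous_intros V_right stopped_right) auto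

lemma N_right: "continuous (at_right a) N"
  unfolding negative_variation_def by (intro continuous_intros V_right stopped_right) auto

lemma V_eq: "V = (\<lambda>t. P t + N t)"
  by (auto simp: fun_eq_iff positive_variation_def negative_variation_def field_simps)

lemma P_minus_N: "0 \<le> t \<Longrightarrow> P t - N t = g t - g 0"
  by (simp add: positive_variation_def negative_variation_def field_simps)

lemma nn_integral_V:
  "h \<in> borel_measurable borel \<Longrightarrow> (\<integral>\<^sup>+s. h s \<partial>variation_measure g)
    = (\<integral>\<^sup>+s. h s \<partial>interval_measure P) + (\<integral>\<^sup>+s. h s \<partial>interval_measure N)"
  unfolding variation_measure_def V_eq
  by (rule nn_integral_interval_measure_sum[OF P_mono P_right N_mono N_right])

lemma integrable_V_iff:
  fixes h :: "real \<Rightarrow> real"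
  shows "integrable (variation_measure g) h
    \<longleftrightarrow> integrable (interval_measure P) h \<and> integrable (interval_measure N) h"
  by (auto simp: integrable_iff_bounded nn_integral_V cong: measurable_cong_sets)

lemma integral_V:
  fixes h :: "real \<Rightarrow> real"
  assumes "integrable (variation_measure g) h" "\<And>s. 0 \<le> h s"
  shows "(\<integral>s. h s \<partial>variation_measure g)
    = (\<integral>s. h s \<partial>interval_measure P) + (\<integral>s. h s \<partial>interval_measure N)"
proof -
  have i: "integrable (interval_measure P) h" "integrable (interval_measure N) h"
    using assms(1) integrable_V_iff by auto
  have "ennreal (\<integral>s. h s \<partial>variation_measure g) = ennreal ((\<integral>s. h s \<partial>interval_measure P) + (\<integral>s. h s \<partial>interval_measure N))"
    using assms i nn_integral_V[of "\<lambda>s. ennreal (h s)"] borel_measurable_integrable[OF i(1)]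
    by (simp add: nn_integral_eq_integral)
  then show ?thesis using assms(2) by (simp add: integral_nonneg flip: ennreal_plus)
qed

text \<open>This domination by the variation measure is the only way in which errors of integrands are
  estimated below.\<close>

lemma abs_stieltjes_le:
  assumes "integrable (variation_measure g) h"
  shows "\<bar>stieltjes g h\<bar> \<le> (\<integral>s. \<bar>h s\<bar> \<partial>variation_measure g)"
proof -
  have "(\<integral>s. \<bar>h s\<bar> \<partial>variation_measure g) = (\<integral>s. \<bar>h s\<bar> \<partial>interval_measure P) + (\<integral>s. \<bar>h s\<bar> \<partial>interval_measure N)"
    using assms by (intro integral_V) auto
  moreover have "\<bar>\<integral>s. h s \<partial>M\<bar> \<le> (\<integral>s. \<bar>h s\<bar> \<partial>M)" for M :: "real measure"
    using integral_norm_bound[of M h] by simp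
  ultimately show ?thesis unfolding stieltjes_def
    by (smt (verit))
qed

lemma stieltjes_add:
  assumes "integrable (variation_measure g) h" "integrable (variation_measure g) k"
  shows "stieltjes g (\<lambda>s. h s + k s) = stieltjes g h + stieltjes g k"
  using assms by (simp add: stieltjes_def integrable_V_iff)

lemma stieltjes_diff:
  assumes "integrable (variation_measure g) h" "integrable (variation_measure g) k"
  shows "stieltjes g (\<lambda>s. h s - k s) = stieltjes g h - stieltjes g k"
  using assms by (simp add: stieltjes_def integrable_V_iff)

lemma stieltjes_cmult: "stieltjes g (\<lambda>s. c * h s) = c * stieltjes g h"
  by (simp add: stieltjes_def algebra_simps)

lemma stieltjes_sum:
  assumes "\<And>i. i \<in> I \<Longrightarrow> integrable (variation_measure g) (h i)"
  shows "stieltjes g (\<lambda>s. \<Sum>i\<in>I. h i s) = (\<Sum>i\<in>I. stieltjes g (h i))"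
  using assms by (simp add: stieltjes_def integrable_V_iff sum_subtractf)

lemma emeasure_V_Ioc: "a \<le> b \<Longrightarrow> emeasure (variation_measure g) {a<..b} = ennreal (V b - V a)"
  unfolding variation_measure_def by (rule emeasure_interval_measure_Ioc[OF _ V_mono V_right])

lemma measure_V_Ioc: "a \<le> b \<Longrightarrow> measure (variation_measure g) {a<..b} = V b - V a"
  unfolding variation_measure_def by (rule measure_interval_measure_Ioc[OF _ V_mono V_right])

lemma integrable_indicator_Ioc: "integrable (variation_measure g) (\<lambda>s. indicator {a<..b} s :: real)"
  by (cases "a \<le> b") (auto intro!: integrable_real_indicator simp: emeasure_V_Ioc)

lemma stieltjes_indicator_Ioc:
  assumes "0 \<le> a" "a \<le> b"
  shows "stieltjes g (indicator {a<..b}) = g b - g a"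
proof -
  have "stieltjes g (indicator {a<..b}) = (P b - P a) - (N b - N a)"
    using assms measure_interval_measure_Ioc[OF _ P_mono P_right, of a b]
      measure_interval_measure_Ioc[OF _ N_mono N_right, of a b]
    by (simp add: stieltjes_def)
  then show ?thesis using P_minus_N[of a] P_minus_N[of b] assms by simp
qed

lemma integrable_bounded:
  fixes h :: "real \<Rightarrow> real"
  assumes "h \<in> borel_measurable borel" "\<And>s. \<bar>h s\<bar> \<le> B * indicator {0<..t} s"
  shows "integrable (variation_measure g) h"
proof (rule Bochner_Integration.integrable_bound)
  show "integrable (variation_measure g) (\<lambda>s. B * indicator {0<..t} s)"
    by (intro integrable_mult_right integrable_indicator_Ioc)
  show "h \<in> borel_measurable (variation_measure g)" using assms(1) by simp
  show "AE s in variation_measure g. norm (h s) \<le> norm (B * indicator {0<..t} s)"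
    using assms(2) by (auto intro!: AE_I2 intro: order_trans abs_ge_self)
qed

lemma stieltjes_tendsto:
  assumes m: "\<And>n::nat. h n \<in> borel_measurable borel" and b: "\<And>n s. \<bar>h n s\<bar> \<le> B * indicator {0<..t} s"
    and l: "\<And>s. (\<lambda>n. h n s) \<longlonglongrightarrow> k s" and k: "k \<in> borel_measurable borel"
  shows "(\<lambda>n. stieltjes g (h n)) \<longlonglongrightarrow> stieltjes g k"
proof -
  have i: "integrable (variation_measure g) (\<lambda>s. B * indicator {0<..t} s)"
    by (intro integrable_mult_right integrable_indicator_Ioc)
  show ?thesis
    unfolding stieltjes_def
    by (intro tendsto_diff; rule integral_dominated_convergence[where w = "\<lambda>s. B * indicator {0<..t} s"])
       (use i m b l k in \<open>auto simp: integrable_V_iff\<close>)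
qed

lemma increment_at_left: "0 < s \<Longrightarrow> ((\<lambda>u. g (max 0 s) - g (max 0 u)) \<longlongrightarrow> jump g s) (at_left s)"
proof -
  assume s: "0 < s"
  have "((\<lambda>u. g s - g u) \<longlongrightarrow> jump g s) (at_left s)"
    unfolding jump_def by (intro tendsto_intros cadlag_left cadlag s)
  then show ?thesis
    by (rule Lim_transform_eventually)
       (use s in \<open>auto simp: eventually_at_left_field max_def intro!: exI[of _ 0]\<close>)
qed

text \<open>The variation function jumps by exactly \<open>\<bar>jump g s\<bar>\<close>.  Hence times at which \<open>g\<close> is continuous are null for the
  variation measure, and a sum over jumps of products \<open>h s * \<bar>jump g s\<bar>\<close> is an integral.\<close>

lemma atoms:
  assumes "0 < s"
  shows "emeasure (variation_measure g) {s} = ennreal \<bar>jump g s\<bar>"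
    "measure (variation_measure g) {s} = \<bar>jump g s\<bar>"
    "measure (interval_measure P) {s} - measure (interval_measure N) {s} = jump g s"
proof -
  note j = total_variation_jump[OF fv cadlag assms] increment_at_left[OF assms]
  show "emeasure (variation_measure g) {s} = ennreal \<bar>jump g s\<bar>"
    "measure (variation_measure g) {s} = \<bar>jump g s\<bar>"
    using interval_measure_singleton[OF V_mono V_right j(1)] by (auto simp: variation_measure_def)
  have "((\<lambda>u. P s - P u) \<longlongrightarrow> (\<bar>jump g s\<bar> + jump g s) / 2) (at_left s)"
    using tendsto_divide[OF tendsto_add[OF j] tendsto_const[of 2]]
    by (simp add: positive_variation_def diff_divide_distrib[symmetric] algebra_simps)
  moreover have "((\<lambda>u. N s - N u) \<longlongrightarrow> (\<bar>jump g s\<bar> - jump g s) / 2) (at_left s)"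
    using tendsto_divide[OF tendsto_diff[OF j] tendsto_const[of 2]]
    by (simp add: negative_variation_def diff_divide_distrib[symmetric] algebra_simps)
  ultimately show "measure (interval_measure P) {s} - measure (interval_measure N) {s} = jump g s"
    using interval_measure_singleton[OF P_mono P_right] interval_measure_singleton[OF N_mono N_right]
    by (simp add: field_simps)
qed

lemma atoms_finite:
  "emeasure (interval_measure P) {s} < \<infinity>" "emeasure (interval_measure N) {s} < \<infinity>"
  "emeasure (variation_measure g) {s} < \<infinity>"
proof -
  have *: "emeasure (interval_measure F) {s} < \<infinity>"
    if "\<And>x y. x \<le> y \<Longrightarrow> F x \<le> F y" "\<And>a. continuous (at_right a) F" for F
  proof -
    have "emeasure (interval_measure F) {s} \<le> emeasure (interval_measure F) {s-1<..s}"
      by (intro emeasure_mono) auto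
    also have "\<dots> < \<infinity>" using emeasure_interval_measure_Ioc[OF _ that, of "s-1" s] by simp
    finally show ?thesis .
  qed
  show "emeasure (interval_measure P) {s} < \<infinity>" "emeasure (interval_measure N) {s} < \<infinity>"
    "emeasure (variation_measure g) {s} < \<infinity>"
    using *[OF P_mono P_right] *[OF N_mono N_right] *[OF V_mono V_right] by (auto simp: variation_measure_def)
qed

lemma stieltjes_jumps:
  assumes "integrable (variation_measure g) h" "countable J" "J \<subseteq> {0<..}" "\<And>s. s \<notin> J \<Longrightarrow> h s = 0"
  shows "((\<lambda>s. h s * jump g s) has_sum stieltjes g h) J"
proof -
  have i: "integrable (interval_measure P) h" "integrable (interval_measure N) h"
    using assms(1) integrable_V_iff by auto
  have "((\<lambda>s. h s * measure (interval_measure P) {s} + - (h s * measure (interval_measure N) {s})) has_sum stieltjes g h) J"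
    unfolding stieltjes_def diff_conv_add_uminus[of "integral\<^sup>L _ _"]
    by (intro has_sum_add has_sum_uminusI has_sum_integral_countable_support i assms atoms_finite) auto
  then show ?thesis
    by (rule has_sum_cong[THEN iffD1, rotated])
       (use assms(3) in \<open>auto simp: right_diff_distrib[symmetric] atoms(3)\<close>)
qed

lemma integral_variation_jumps:
  fixes h :: "real \<Rightarrow> real"
  assumes "integrable (variation_measure g) h" "countable J" "J \<subseteq> {0<..}" "\<And>s. s \<notin> J \<Longrightarrow> h s = 0"
  shows "((\<lambda>s. h s * \<bar>jump g s\<bar>) has_sum (\<integral>s. h s \<partial>variation_measure g)) J"
proof -
  have "((\<lambda>s. h s * measure (variation_measure g) {s}) has_sum (\<integral>s. h s \<partial>variation_measure g)) J"
    by (intro has_sum_integral_countable_support assms atoms_finite) auto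
  then show ?thesis
    by (rule has_sum_cong[THEN iffD1, rotated]) (use assms(3) in \<open>auto simp: atoms(2)\<close>)
qed

end

section \<open>Regularity of cadlag paths\<close>

text \<open>Boundedness is a local property at every time by the existence of one-sided limits, and
  bisection passes from small intervals to \<open>[0, t]\<close>.\<close>

lemma cadlag_bounded:
  assumes "cadlag x" "0 \<le> t"
  obtains B where "0 \<le> B" "\<And>s. 0 \<le> s \<Longrightarrow> s \<le> t \<Longrightarrow> \<bar>x s\<bar> \<le> B"
proof -
  have "0 \<le> (0::real) \<longrightarrow> (\<exists>B. \<forall>s\<in>{0..t}. \<bar>x s\<bar> \<le> B)"
  proof (rule Bolzano[where P = "\<lambda>a b. 0 \<le> a \<longrightarrow> (\<exists>B. \<forall>s\<in>{a..b}. \<bar>x s\<bar> \<le> B)"])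
    fix a b c :: real
    assume *: "0 \<le> a \<longrightarrow> (\<exists>B. \<forall>s\<in>{a..b}. \<bar>x s\<bar> \<le> B)" "0 \<le> b \<longrightarrow> (\<exists>B. \<forall>s\<in>{b..c}. \<bar>x s\<bar> \<le> B)" "a \<le> b" "b \<le> c"
    show "0 \<le> a \<longrightarrow> (\<exists>B. \<forall>s\<in>{a..c}. \<bar>x s\<bar> \<le> B)"
    proof
      assume "0 \<le> a"
      with * obtain B C where "\<forall>s\<in>{a..b}. \<bar>x s\<bar> \<le> B" "\<forall>s\<in>{b..c}. \<bar>x s\<bar> \<le> C" by fastforce
      then have "\<forall>s\<in>{a..c}. \<bar>x s\<bar> \<le> max B C" by (force simp: le_max_iff_disj)
      then show "\<exists>B. \<forall>s\<in>{a..c}. \<bar>x s\<bar> \<le> B" ..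
    qed
  next
    fix u :: real assume u: "0 \<le> u" "u \<le> t"
    have "\<forall>\<^sub>F s in at_right u. \<bar>x s - x u\<bar> < 1"
      using tendstoD[OF cadlag_right[OF assms(1) u(1)], of 1] by (simp add: dist_real_def)
    then obtain r where r: "u < r" "\<And>s. u < s \<Longrightarrow> s < r \<Longrightarrow> \<bar>x s - x u\<bar> < 1"
      by (auto simp: eventually_at_right_field)
    obtain l where l: "l < u" "\<And>s. 0 \<le> s \<Longrightarrow> l < s \<Longrightarrow> s < u \<Longrightarrow> \<bar>x s - left_lim x u\<bar> < 1"
    proof (cases "u = 0")
      case True
      then show ?thesis using that[of "-1"] by auto
    next
      case False
      then have "\<forall>\<^sub>F s in at_left u. \<bar>x s - left_lim x u\<bar> < 1"
        using tendstoD[OF cadlag_left[OF assms(1)], of u 1] u by (simp add: dist_real_def)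
      then show ?thesis using that by (auto simp: eventually_at_left_field)
    qed
    show "\<exists>d>0. \<forall>a b. a \<le> u \<and> u \<le> b \<and> b - a < d \<longrightarrow> 0 \<le> a \<longrightarrow> (\<exists>B. \<forall>s\<in>{a..b}. \<bar>x s\<bar> \<le> B)"
    proof (intro exI conjI allI impI)
      show "0 < min (r - u) (u - l)" using r l by simp
      fix a b assume ab: "a \<le> u \<and> u \<le> b \<and> b - a < min (r - u) (u - l)" "0 \<le> a"
      show "\<forall>s\<in>{a..b}. \<bar>x s\<bar> \<le> \<bar>x u\<bar> + \<bar>left_lim x u\<bar> + 1"
      proof
        fix s assume "s \<in> {a..b}"
        then consider "s = u" | "u < s" "s < r" | "s < u" "l < s" "0 \<le> s" using ab by force
        then show "\<bar>x s\<bar> \<le> \<bar>x u\<bar> + \<bar>left_lim x u\<bar> + 1"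
          using r(2)[of s] l(2)[of s] by cases auto
      qed
    qed
  qed (use assms in auto)
  then obtain B where "\<forall>s\<in>{0..t}. \<bar>x s\<bar> \<le> B" by auto
  then show ?thesis using that[of "\<bar>B\<bar>"] by force
qed

text \<open>Every property that defines a closed set passes from the path to its left limits.\<close>

lemma left_lim_closed:
  assumes "cadlag x" "0 < s" "closed S" "l < s" "\<And>u. l < u \<Longrightarrow> u < s \<Longrightarrow> x u \<in> S"
  shows "left_lim x s \<in> S"
proof (rule Lim_in_closed_set[OF assms(3) _ _ cadlag_left[OF assms(1,2)]])
  show "\<forall>\<^sub>F u in at_left s. x u \<in> S"
    using assms by (auto simp: eventually_at_left_field)
qed simp

lemma left_lim_bounded:
  assumes "cadlag x" "0 < s" "s \<le> t" "\<And>s. 0 \<le> s \<Longrightarrow> s \<le> t \<Longrightarrow> \<bar>x s\<bar> \<le> B"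
  shows "\<bar>left_lim x s\<bar> \<le> B"
proof -
  have "left_lim x s \<in> {-B..B}"
    using assms by (intro left_lim_closed[of x s "{-B..B}" 0]) (auto simp: abs_le_iff minus_le_iff)
  then show ?thesis by auto
qed

lemma left_lim_dist:
  assumes "cadlag x" "cadlag y" "0 < s" "\<And>s. 0 \<le> s \<Longrightarrow> \<bar>x s - y s\<bar> \<le> e"
  shows "\<bar>left_lim x s - left_lim y s\<bar> \<le> e"
proof (rule tendsto_upperbound)
  show "((\<lambda>u. \<bar>x u - y u\<bar>) \<longlongrightarrow> \<bar>left_lim x s - left_lim y s\<bar>) (at_left s)"
    by (intro tendsto_intros cadlag_left assms)
  show "\<forall>\<^sub>F u in at_left s. \<bar>x u - y u\<bar> \<le> e"
    using assms by (auto simp: eventually_at_left_field intro!: exI[of _ 0])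
qed simp

lemma left_lim_left_continuous:
  assumes "cadlag x" "0 < s"
  shows "(left_lim x \<longlongrightarrow> left_lim x s) (at_left s)"
proof (rule tendstoI)
  fix e :: real assume "0 < e"
  then have "\<forall>\<^sub>F u in at_left s. dist (x u) (left_lim x s) < e/2"
    using tendstoD[OF cadlag_left[OF assms], of "e/2"] by simp
  then obtain l where l: "l < s" "\<And>u. l < u \<Longrightarrow> u < s \<Longrightarrow> dist (x u) (left_lim x s) < e/2"
    by (auto simp: eventually_at_left_field)
  have "dist (left_lim x u) (left_lim x s) < e" if "max l 0 < u" "u < s" for u
  proof -
    have "left_lim x u \<in> cball (left_lim x s) (e/2)"
      using that by (intro left_lim_closed[OF assms(1), of u _ "max l 0"])
        (auto simp: dist_commute[of "left_lim x s"] intro!: less_imp_le l(2) simp del: less_divide_eq_numeral1 le_divide_eq_numeral1)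
    then have "dist (left_lim x u) (left_lim x s) \<le> e/2" by (simp add: dist_commute)
    then show ?thesis using \<open>0 < e\<close> by linarith
  qed
  then show "\<forall>\<^sub>F u in at_left s. dist (left_lim x u) (left_lim x s) < e"
    using l(1) assms(2) by (auto simp: eventually_at_left_field intro!: exI[of _ "max l 0"])
qed

lemma left_lim_right_limit:
  assumes "cadlag x" "0 \<le> s"
  shows "(left_lim x \<longlongrightarrow> x s) (at_right s)"
proof (rule tendstoI)
  fix e :: real assume "0 < e"
  then have "\<forall>\<^sub>F u in at_right s. dist (x u) (x s) < e/2"
    using tendstoD[OF cadlag_right[OF assms], of "e/2"] by simp
  then obtain r where r: "s < r" "\<And>u. s < u \<Longrightarrow> u < r \<Longrightarrow> dist (x u) (x s) < e/2"
    by (auto simp: eventually_at_right_field)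
  have "dist (left_lim x u) (x s) < e" if "s < u" "u < r" for u
  proof -
    have "left_lim x u \<in> cball (x s) (e/2)"
      using that assms(2) by (intro left_lim_closed[OF assms(1), of u _ s])
        (auto simp: dist_commute[of "x s"] intro!: less_imp_le r(2) simp del: less_divide_eq_numeral1 le_divide_eq_numeral1)
    then have "dist (left_lim x u) (x s) \<le> e/2" by (simp add: dist_commute)
    then show ?thesis using \<open>0 < e\<close> by linarith
  qed
  then show "\<forall>\<^sub>F u in at_right s. dist (left_lim x u) (x s) < e"
    using r(1) by (auto simp: eventually_at_right_field)
qed

text \<open>Left continuity makes it possible to use only the intervals \<open>(a, b]\<close>, whose
  Stieltjes measure is an increment of the integrator, as steps.\<close>

lemma caglad_step_approximation:
  fixes h :: "real \<Rightarrow> real"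
  assumes l: "\<And>s. 0 < s \<Longrightarrow> (h \<longlongrightarrow> h s) (at_left s)"
    and r: "\<And>s. 0 \<le> s \<Longrightarrow> \<exists>m. (h \<longlongrightarrow> m) (at_right s)" and t: "0 \<le> t" and e: "0 < e"
  obtains S :: "(real \<times> real \<times> real) list" where
    "\<And>c a b. (c, a, b) \<in> set S \<Longrightarrow> 0 \<le> a \<and> a \<le> b \<and> b \<le> t"
    "\<And>s. 0 < s \<Longrightarrow> s \<le> t \<Longrightarrow> \<bar>h s - (\<Sum>(c, a, b)\<leftarrow>S. c * indicator {a<..b} s)\<bar> \<le> e"
proof -
  define step where "step S s = (\<Sum>(c, a, b)\<leftarrow>S. c * (indicator {a<..b} s :: real))" for S :: "(real \<times> real \<times> real) list" and s :: real
  define ok where "ok u v S \<longleftrightarrow> (\<forall>(c, a, b)\<in>set S. u \<le> a \<and> a \<le> b \<and> b \<le> v) \<and> (\<forall>s\<in>{u<..v}. \<bar>h s - step S s\<bar> \<le> e)" for u v S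
  have zero: "step S s = 0" if "ok u v S" "s \<notin> {u<..v}" for u v S s
  proof -
    have "(\<Sum>(c, a, b)\<leftarrow>S. c * (indicator {a<..b} s :: real)) = (\<Sum>_\<leftarrow>S. 0)"
      using that by (intro arg_cong[of _ _ sum_list] map_cong) (fastforce simp: ok_def indicator_def)+
    then show ?thesis by (simp add: step_def)
  qed
  have app: "step (S @ T) s = step S s + step T s" for S T s by (simp add: step_def)
  have "0 \<le> (0::real) \<longrightarrow> (\<exists>S. ok 0 t S)"
  proof (rule Bolzano[where P = "\<lambda>u v. 0 \<le> u \<longrightarrow> (\<exists>S. ok u v S)"])
    fix a b c :: real
    assume *: "0 \<le> a \<longrightarrow> (\<exists>S. ok a b S)" "0 \<le> b \<longrightarrow> (\<exists>S. ok b c S)" "a \<le> b" "b \<le> c"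
    show "0 \<le> a \<longrightarrow> (\<exists>S. ok a c S)"
    proof
      assume "0 \<le> a"
      with * obtain S T where ST: "ok a b S" "ok b c T" by fastforce
      have "\<bar>h s - step (S @ T) s\<bar> \<le> e" if "s \<in> {a<..c}" for s
        using that ST zero[OF ST(1), of s] zero[OF ST(2), of s] by (cases "s \<le> b") (auto simp: app ok_def)
      moreover have "\<forall>(k, u, v)\<in>set (S @ T). a \<le> u \<and> u \<le> v \<and> v \<le> c"
        using ST * by (fastforce simp: ok_def)
      ultimately have "ok a c (S @ T)" by (auto simp: ok_def)
      then show "\<exists>S. ok a c S" ..
    qed
  next
    fix u :: real assume u: "0 \<le> u" "u \<le> t"
    obtain m where m: "(h \<longlongrightarrow> m) (at_right u)" using r u by blast
    have "\<forall>\<^sub>F s in at_right u. \<bar>h s - m\<bar> < e"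
      using tendstoD[OF m e] by (simp add: dist_real_def)
    then obtain r where r: "u < r" "\<And>s. u < s \<Longrightarrow> s < r \<Longrightarrow> \<bar>h s - m\<bar> < e"
      by (auto simp: eventually_at_right_field)
    obtain l where l: "l < u" "\<And>s. 0 \<le> s \<Longrightarrow> l < s \<Longrightarrow> s < u \<Longrightarrow> \<bar>h s - h u\<bar> < e"
    proof (cases "u = 0")
      case True
      then show ?thesis using that[of "-1"] by auto
    next
      case False
      then have "\<forall>\<^sub>F s in at_left u. \<bar>h s - h u\<bar> < e"
        using tendstoD[OF l[of u] e] u by (simp add: dist_real_def)
      then show ?thesis using that by (auto simp: eventually_at_left_field)
    qed
    show "\<exists>d>0. \<forall>a b. a \<le> u \<and> u \<le> b \<and> b - a < d \<longrightarrow> 0 \<le> a \<longrightarrow> (\<exists>S. ok a b S)"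
    proof (intro exI conjI allI impI)
      show "0 < min (r - u) (u - l)" using r l by simp
      fix a b assume ab: "a \<le> u \<and> u \<le> b \<and> b - a < min (r - u) (u - l)" "0 \<le> a"
      show "ok a b [(h u, a, u), (m, u, b)]"
        unfolding ok_def
      proof
        show "\<forall>s\<in>{a<..b}. \<bar>h s - step [(h u, a, u), (m, u, b)] s\<bar> \<le> e"
        proof
          fix s assume s: "s \<in> {a<..b}"
          then consider "s = u" | "u < s" "s < r" | "s < u" "l < s" "0 \<le> s" using ab by force
          then show "\<bar>h s - step [(h u, a, u), (m, u, b)] s\<bar> \<le> e"
            using r(2)[of s] l(2)[of s] e s by cases (auto simp: step_def)
        qed
      qed (use ab in auto)
    qed
  qed (use t in auto)
  then obtain S where "ok 0 t S" by auto
  then show ?thesis by (intro that[of S]) (auto simp: ok_def step_def)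
qed

section \<open>Riemann sums along uniform grids\<close>

definition grid_point :: "real \<Rightarrow> nat \<Rightarrow> nat \<Rightarrow> real" where
  "grid_point t n i = t * real i / real n"

lemma grid_point_mono: "0 < t \<Longrightarrow> i \<le> j \<Longrightarrow> grid_point t n i \<le> grid_point t n j"
  by (simp add: grid_point_def divide_right_mono)

lemma grid_point_bounds: "0 < t \<Longrightarrow> 0 \<le> grid_point t n i" "0 < t \<Longrightarrow> i \<le> n \<Longrightarrow> grid_point t n i \<le> t"
  by (auto simp: grid_point_def divide_simps)

lemma grid_point_Suc: "grid_point t n (Suc i) = grid_point t n i + t * inverse (real n)"
  by (simp add: grid_point_def divide_inverse algebra_simps)

text \<open>A function of the path at both endpoints of a cell, which tends to a function of
  the left limit and the value; the same object serves to show measurability of the latter.\<close>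

definition grid_function :: "(real \<Rightarrow> real \<Rightarrow> real) \<Rightarrow> (real \<Rightarrow> real) \<Rightarrow> real \<Rightarrow> nat \<Rightarrow> real \<Rightarrow> real" where
  "grid_function \<Phi> y t n s =
     (\<Sum>i<n. \<Phi> (y (grid_point t n i)) (y (grid_point t n (Suc i)))
        * indicator {grid_point t n i<..grid_point t n (Suc i)} s)"

lemma grid_function_measurable [measurable]: "grid_function \<Phi> y t n \<in> borel_measurable borel"
  unfolding grid_function_def by measurable

lemma grid_cell:
  assumes "0 < s" "s \<le> t" "0 < n"
  obtains i where "i < n" "grid_point t n i < s" "s \<le> grid_point t n (Suc i)"
proof -
  define k where "k = \<lceil>s * n / t\<rceil>"
  have t: "0 < t" using assms by linarith
  have pos: "0 < s * n / t" "s * n / t \<le> n" using assms t by (auto simp: divide_simps)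
  then have k: "0 < k" "k \<le> int n" by (auto simp: k_def ceiling_le_iff)
  have c: "real_of_int k - 1 < s * n / t" "s * n / t \<le> real_of_int k"
    unfolding k_def by linarith+
  have e: "real (nat (k - 1)) = real_of_int k - 1" "real (Suc (nat (k - 1))) = real_of_int k"
    using k by auto
  show ?thesis
  proof (rule that[of "nat (k - 1)"])
    show "nat (k - 1) < n" using k by linarith
    show "grid_point t n (nat (k - 1)) < s" "s \<le> grid_point t n (Suc (nat (k - 1)))"
      unfolding e grid_point_def using c t assms(3) by (simp_all add: field_simps)
  qed
qed

text \<open>The cells of a grid are disjoint, so only the cell that contains \<open>s\<close> contributes.\<close>

lemma grid_function_eq:
  assumes "0 < t" "i < n" "grid_point t n i < s" "s \<le> grid_point t n (Suc i)"
  shows "grid_function \<Phi> y t n s = \<Phi> (y (grid_point t n i)) (y (grid_point t n (Suc i)))"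
proof -
  have disj: "j = i" if "grid_point t n j < s" "s \<le> grid_point t n (Suc j)" for j
  proof (rule ccontr)
    assume "j \<noteq> i"
    then consider "Suc i \<le> j" | "Suc j \<le> i" by linarith
    then show False
      using that assms grid_point_mono[OF assms(1), of "Suc i" j n] grid_point_mono[OF assms(1), of "Suc j" i n]
      by cases linarith+
  qed
  have "grid_function \<Phi> y t n s
      = (\<Sum>j<n. if j = i then \<Phi> (y (grid_point t n i)) (y (grid_point t n (Suc i))) else 0)"
    unfolding grid_function_def
  proof (rule sum.cong)
    fix j
    have "indicator {grid_point t n j<..grid_point t n (Suc j)} s = (if j = i then 1 else (0::real))"
    proof (cases "j = i")
      case True
      then show ?thesis using assms by simp
    next
      case False
      then have "s \<notin> {grid_point t n j<..grid_point t n (Suc j)}"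
        using disj[of j] unfolding greaterThanAtMost_iff by blast
      then show ?thesis using False by (simp only: indicator_simps(2) if_False not_False_eq_True)
    qed
    then
    show "\<Phi> (y (grid_point t n j)) (y (grid_point t n (Suc j))) * indicator {grid_point t n j<..grid_point t n (Suc j)} s
        = (if j = i then \<Phi> (y (grid_point t n i)) (y (grid_point t n (Suc i))) else 0)"
      by (cases "j = i") (simp_all only: if_True if_False mult_1_right mult_zero_right simp_thms)
  qed simp
  then show ?thesis using assms by simp
qed

lemma grid_function_outside:
  assumes "0 < t" "s \<notin> {0<..t}"
  shows "grid_function \<Phi> y t n s = 0"
  unfolding grid_function_def
proof (rule sum.neutral, rule ballI)
  fix i assume "i \<in> {..<n}"
  then have "s \<notin> {grid_point t n i<..grid_point t n (Suc i)}"
    using assms(2) grid_point_bounds(1)[OF assms(1), of n i] grid_point_bounds(2)[OF assms(1), of "Suc i" n] by auto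
  then have "indicator {grid_point t n i<..grid_point t n (Suc i)} s = (0::real)"
    by (rule indicator_simps(2))
  then show "\<Phi> (y (grid_point t n i)) (y (grid_point t n (Suc i))) * indicator {grid_point t n i<..grid_point t n (Suc i)} s = 0"
    by (simp only: mult_zero_right)
qed

lemma grid_function_bounded:
  assumes "0 < t" "\<And>a b. a \<in> {0..t} \<Longrightarrow> b \<in> {0..t} \<Longrightarrow> \<bar>\<Phi> (y a) (y b)\<bar> \<le> C"
  shows "\<bar>grid_function \<Phi> y t n s\<bar> \<le> C * indicator {0<..t} s"
proof (cases "s \<in> {0<..t} \<and> 0 < n")
  case True
  then obtain i where i: "i < n" "grid_point t n i < s" "s \<le> grid_point t n (Suc i)"
    using grid_cell[of s t n] by auto
  have "grid_point t n i \<in> {0..t}" "grid_point t n (Suc i) \<in> {0..t}"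
    using i(1) grid_point_bounds[OF assms(1), of n] grid_point_bounds(2)[OF assms(1), of _ n] by auto
  then show ?thesis
    using grid_function_eq[OF assms(1) i, of \<Phi> y] True assms(2) by simp
next
  case False
  have "0 \<le> C" using assms(2)[of 0 0] assms(1) by auto
  then show ?thesis
    using False grid_function_outside[OF assms(1)] by (auto simp: grid_function_def)
qed

text \<open>The left grid point approaches \<open>s\<close> strictly from the left, the right grid point from the
  right, possibly with equality; this is where the path has to be cadlag.\<close>

lemma grid_function_tendsto:
  assumes y: "cadlag y" and s: "0 < s" "s \<le> t"
    and \<Phi>: "continuous_on UNIV (\<lambda>z. \<Phi> (fst z) (snd z))"
  shows "(\<lambda>n. grid_function \<Phi> y t (Suc n) s) \<longlonglongrightarrow> \<Phi> (left_lim y s) (y s)"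
proof -
  have t: "0 < t" using s by linarith
  have "\<exists>i. i < Suc n \<and> grid_point t (Suc n) i < s \<and> s \<le> grid_point t (Suc n) (Suc i)" for n
    using grid_cell[OF s, of "Suc n"] by blast
  then obtain i where i: "\<And>n. i n < Suc n" "\<And>n. grid_point t (Suc n) (i n) < s"
    "\<And>n. s \<le> grid_point t (Suc n) (Suc (i n))"
    by metis
  define l where "l n = grid_point t (Suc n) (i n)" for n
  define u where "u n = grid_point t (Suc n) (Suc (i n))" for n
  have ul: "u n = l n + t * inverse (real (Suc n))" for n
    by (simp only: u_def l_def grid_point_Suc)
  have ls: "l n < s" "s \<le> u n" for n using i by (auto simp: l_def u_def)
  have inv: "(\<lambda>n. t * inverse (real (Suc n))) \<longlonglongrightarrow> 0"
    using tendsto_mult[OF tendsto_const[of t] LIMSEQ_inverse_real_of_nat] by simp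
  have lim_l: "l \<longlonglongrightarrow> s"
  proof (rule tendsto_sandwich[OF _ _ _ tendsto_const])
    show "\<forall>\<^sub>F n in sequentially. s - t * inverse (real (Suc n)) \<le> l n"
    proof (intro always_eventually allI)
      fix n show "s - t * inverse (real (Suc n)) \<le> l n" using ls(2)[of n] ul[of n] by linarith
    qed
    show "\<forall>\<^sub>F n in sequentially. l n \<le> s" using ls(1) by (simp add: less_imp_le)
    show "(\<lambda>n. s - t * inverse (real (Suc n))) \<longlonglongrightarrow> s"
      using tendsto_diff[OF tendsto_const[of s] inv] by simp
  qed
  have lim_u: "u \<longlonglongrightarrow> s"
  proof -
    have "(\<lambda>n. l n + t * inverse (real (Suc n))) \<longlonglongrightarrow> s" using tendsto_add[OF lim_l inv] by simp
    then show ?thesis unfolding ul[symmetric] .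
  qed
  have yl: "(\<lambda>n. y (l n)) \<longlonglongrightarrow> left_lim y s"
  proof (rule filterlim_compose[OF cadlag_left[OF y s(1)]])
    show "filterlim l (at_left s) sequentially"
      unfolding filterlim_at using lim_l ls(1) by (auto simp: less_imp_neq)
  qed
  have yu: "(\<lambda>n. y (u n)) \<longlonglongrightarrow> y s"
  proof (rule tendstoI)
    fix e :: real assume e: "0 < e"
    have "\<forall>\<^sub>F v in at_right s. dist (y v) (y s) < e"
      using tendstoD[OF cadlag_right[OF y, of s] e] s by simp
    then obtain b where b: "s < b" "\<And>v. s < v \<Longrightarrow> v < b \<Longrightarrow> dist (y v) (y s) < e"
      by (auto simp: eventually_at_right_field)
    have "\<forall>\<^sub>F n in sequentially. u n < b" using order_tendstoD(2)[OF lim_u b(1)] .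
    then show "\<forall>\<^sub>F n in sequentially. dist (y (u n)) (y s) < e"
    proof eventually_elim
      case (elim n)
      then show ?case using b(2)[of "u n"] ls(2)[of n] e by (cases "u n = s") auto
    qed
  qed
  have "(\<lambda>n. (y (l n), y (u n))) \<longlonglongrightarrow> (left_lim y s, y s)" using yl yu by (rule tendsto_Pair)
  then have "(\<lambda>n. \<Phi> (fst (y (l n), y (u n))) (snd (y (l n), y (u n)))) \<longlonglongrightarrow> \<Phi> (fst (left_lim y s, y s)) (snd (left_lim y s, y s))"
    by (rule continuous_on_tendsto_compose[OF \<Phi>]) auto
  moreover have "grid_function \<Phi> y t (Suc n) s = \<Phi> (y (l n)) (y (u n))" for n
    unfolding l_def u_def by (rule grid_function_eq[OF t i])
  ultimately show ?thesis by simp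
qed

lemma grid_function_tendsto_indicator:
  fixes \<Phi> :: "real \<Rightarrow> real \<Rightarrow> real"
  assumes "cadlag y" "0 < t" "continuous_on UNIV (\<lambda>z. \<Phi> (fst z) (snd z))"
  shows "(\<lambda>n. grid_function \<Phi> y t (Suc n) s) \<longlonglongrightarrow> indicator {0<..t} s * \<Phi> (left_lim y s) (y s)"
  using grid_function_tendsto[OF assms(1) _ _ assms(3), of s t] grid_function_outside[OF assms(2), of s]
  by (cases "s \<in> {0<..t}") auto

lemma cadlag_measurable:
  fixes \<Phi> :: "real \<Rightarrow> real \<Rightarrow> real"
  assumes "cadlag y" "0 < t" "continuous_on UNIV (\<lambda>z. \<Phi> (fst z) (snd z))"
  shows "(\<lambda>s. indicator {0<..t} s * \<Phi> (left_lim y s) (y s)) \<in> borel_measurable borel"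
  by (rule borel_measurable_LIMSEQ_real[OF grid_function_tendsto_indicator[OF assms]]) measurable

section \<open>Divided differences and the chain rule\<close>

text \<open>Here \<open>f\<close> is meant to be the derivative of \<open>F\<close>, which extends the difference quotient continuously to the
  diagonal.\<close>

definition divided_difference :: "(real \<Rightarrow> real) \<Rightarrow> (real \<Rightarrow> real) \<Rightarrow> real \<Rightarrow> real \<Rightarrow> real" where
  "divided_difference F f a b = (if a = b then f a else (F b - F a) / (b - a))"

lemma divided_difference_mult: "divided_difference F f a b * (b - a) = F b - F a"
  by (simp add: divided_difference_def)

lemma divided_difference_mean_value:
  assumes "\<And>u. (F has_real_derivative f u) (at u)"
  obtains z where "divided_difference F f a b = f z" "min a b \<le> z" "z \<le> max a b"
proof -
  consider "a = b" | "a < b" | "b < a" by linarith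
  then show ?thesis
  proof cases
    case 1
    then show ?thesis using that[of a] by (simp add: divided_difference_def)
  next
    case 2
    then obtain z where "a < z" "z < b" "F b - F a = (b - a) * f z"
      using MVT2[of a b F f] assms by auto
    then show ?thesis using that[of z] 2 by (simp add: divided_difference_def)
  next
    case 3
    then obtain z where "b < z" "z < a" "F a - F b = (a - b) * f z"
      using MVT2[of b a F f] assms by auto
    then show ?thesis using that[of z] 3 by (simp add: divided_difference_def field_simps)
  qed
qed

text \<open>The only delicate points are those of the diagonal; there the mean value theorem writes nearby
  divided differences as values of \<open>f\<close> near the diagonal point.\<close>

lemma divided_difference_continuous:
  assumes F: "\<And>u. (F has_real_derivative f u) (at u)" and f: "continuous_on UNIV f"
  shows "continuous_on UNIV (\<lambda>z. divided_difference F f (fst z) (snd z))"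
  unfolding continuous_on_eq_continuous_at[OF open_UNIV] isCont_def
proof (intro ballI, clarify)
  fix a b :: real
  show "((\<lambda>z. divided_difference F f (fst z) (snd z)) \<longlongrightarrow> divided_difference F f (fst (a, b)) (snd (a, b))) (at (a, b))"
  proof (cases "a = b")
    case False
    have ev: "\<forall>\<^sub>F z in at (a, b). fst z \<noteq> snd z"
    proof -
      have "open {z :: real \<times> real. fst z \<noteq> snd z}"
        by (intro open_Collect_neq continuous_intros)
      then show ?thesis using False by (auto simp: eventually_at_topological)
    qed
    have FC: "isCont F u" for u using F DERIV_isCont by blast
    have "((\<lambda>z. (F (snd z) - F (fst z)) / (snd z - fst z)) \<longlongrightarrow> (F b - F a) / (b - a)) (at (a, b))"
      by (intro tendsto_intros isCont_tendsto_compose[OF FC] tendsto_eq_intros) (use False in auto)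
    then have "((\<lambda>z. divided_difference F f (fst z) (snd z)) \<longlongrightarrow> (F b - F a) / (b - a)) (at (a, b))"
      by (rule Lim_transform_eventually)
         (use ev in eventually_elim, auto simp: divided_difference_def)
    then show ?thesis using False by (simp add: divided_difference_def)
  next
    case True
    show ?thesis
    proof (rule tendstoI)
      fix e :: real assume "0 < e"
      obtain d where d: "0 < d" "\<And>u. \<bar>u - a\<bar> < d \<Longrightarrow> \<bar>f u - f a\<bar> < e"
        using f \<open>0 < e\<close> unfolding continuous_on_iff by (metis UNIV_I dist_real_def)
      have "\<forall>\<^sub>F z in at (a, b). \<bar>fst z - a\<bar> < d \<and> \<bar>snd z - a\<bar> < d"
      proof -
        have "open {z :: real \<times> real. \<bar>fst z - a\<bar> < d \<and> \<bar>snd z - a\<bar> < d}"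
          by (intro open_Collect_conj open_Collect_less continuous_intros)
        then show ?thesis using True d(1)
          by (subst eventually_at_topological) (auto intro!: exI[of _ "{z :: real \<times> real. \<bar>fst z - a\<bar> < d \<and> \<bar>snd z - a\<bar> < d}"])
      qed
      then show "\<forall>\<^sub>F z in at (a, b). dist (divided_difference F f (fst z) (snd z)) (divided_difference F f (fst (a, b)) (snd (a, b))) < e"
      proof eventually_elim
        case (elim z)
        obtain w where w: "divided_difference F f (fst z) (snd z) = f w" "min (fst z) (snd z) \<le> w" "w \<le> max (fst z) (snd z)"
          using divided_difference_mean_value[OF F] by metis
        then have "\<bar>w - a\<bar> < d" using elim by linarith
        then show ?case using d(2) w(1) True by (simp add: dist_real_def divided_difference_def)
      qed
    qed
  qed
qed

lemma divided_difference_bounded: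
  assumes F: "\<And>u. (F has_real_derivative f u) (at u)" and C: "\<And>u. \<bar>u\<bar> \<le> B \<Longrightarrow> \<bar>f u\<bar> \<le> C"
    and "\<bar>a\<bar> \<le> B" "\<bar>b\<bar> \<le> B"
  shows "\<bar>divided_difference F f a b\<bar> \<le> C"
proof -
  obtain z where z: "divided_difference F f a b = f z" "min a b \<le> z" "z \<le> max a b"
    using divided_difference_mean_value[OF F] by metis
  then have "\<bar>z\<bar> \<le> B" using assms by linarith
  then show ?thesis using C z by simp
qed

lemma continuous_bounded_on_ball:
  fixes f :: "real \<Rightarrow> real"
  assumes "continuous_on UNIV f"
  obtains C where "0 \<le> C" "\<And>u. \<bar>u\<bar> \<le> B \<Longrightarrow> \<bar>f u\<bar> \<le> C"
proof -
  have "compact (f ` {-B..B})"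
    by (intro compact_continuous_image continuous_on_subset[OF assms]) auto
  then obtain C where C: "\<forall>v\<in>f ` {-B..B}. norm v \<le> C"
    using compact_imp_bounded bounded_iff by blast
  show ?thesis
  proof (rule that[of "\<bar>C\<bar>"])
    show "\<bar>f u\<bar> \<le> \<bar>C\<bar>" if "\<bar>u\<bar> \<le> B" for u
    proof -
      have "u \<in> {-B..B}" using that by auto
      then have "norm (f u) \<le> C" using C by blast
      then show ?thesis by simp
    qed
  qed simp
qed

text \<open>Telescoping \<open>F\<close> along a grid writes \<open>F (g t) - F (g 0)\<close> as the Stieltjes integral of a step
  function, and the step functions converge boundedly as the grid is refined.\<close>

lemma (in fv_path) chain_rule:
  assumes F: "\<And>u. (F has_real_derivative f u) (at u)" and f: "continuous_on UNIV f" and t: "0 < t"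
  shows "ls_integral g t (\<lambda>s. divided_difference F f (left_lim g s) (g s)) = F (g t) - F (g 0)"
proof -
  let ?dd = "divided_difference F f"
  obtain B where B: "\<And>s. 0 \<le> s \<Longrightarrow> s \<le> t \<Longrightarrow> \<bar>g s\<bar> \<le> B"
    using cadlag_bounded[OF cadlag] t by (metis less_imp_le)
  obtain C where C: "\<And>u. \<bar>u\<bar> \<le> B \<Longrightarrow> \<bar>f u\<bar> \<le> C" using continuous_bounded_on_ball[OF f] by metis
  have dd: "continuous_on UNIV (\<lambda>z. ?dd (fst z) (snd z))" by (rule divided_difference_continuous[OF F f])
  have "(\<lambda>n. stieltjes g (grid_function ?dd g t (Suc n)))
      \<longlonglongrightarrow> stieltjes g (\<lambda>s. indicator {0<..t} s * ?dd (left_lim g s) (g s))"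
  proof (rule stieltjes_tendsto)
    show "\<bar>grid_function ?dd g t (Suc n) s\<bar> \<le> C * indicator {0<..t} s" for n s
      using B by (intro grid_function_bounded t divided_difference_bounded[OF F C]) auto
  qed (intro grid_function_measurable grid_function_tendsto_indicator cadlag_measurable cadlag t dd)+
  moreover have "stieltjes g (grid_function ?dd g t (Suc n)) = F (g t) - F (g 0)" for n
  proof -
    define \<tau> where "\<tau> i = grid_point t (Suc n) i" for i
    have \<tau>: "0 \<le> \<tau> i" "\<tau> i \<le> \<tau> (Suc i)" for i
      using t by (auto simp: \<tau>_def grid_point_bounds grid_point_mono)
    have "stieltjes g (grid_function ?dd g t (Suc n))
        = stieltjes g (\<lambda>s. \<Sum>i<Suc n. ?dd (g (\<tau> i)) (g (\<tau> (Suc i))) * indicator {\<tau> i<..\<tau> (Suc i)} s)"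
      by (simp only: grid_function_def[abs_def] \<tau>_def)
    also have "\<dots> = (\<Sum>i<Suc n. ?dd (g (\<tau> i)) (g (\<tau> (Suc i))) * stieltjes g (indicator {\<tau> i<..\<tau> (Suc i)}))"
      by (subst stieltjes_sum) (auto intro!: integrable_indicator_Ioc simp: stieltjes_cmult)
    also have "\<dots> = (\<Sum>i<Suc n. F (g (\<tau> (Suc i))) - F (g (\<tau> i)))"
      using \<tau> by (intro sum.cong) (simp_all add: stieltjes_indicator_Ioc divided_difference_mult)
    also have "\<dots> = F (g (\<tau> (Suc n))) - F (g (\<tau> 0))"
      by (rule sum_lessThan_telescope)
    also have "\<dots> = F (g t) - F (g 0)" by (simp add: \<tau>_def grid_point_def)
    finally show ?thesis .
  qed
  ultimately show ?thesis
    by (simp add: ls_integral_eq_stieltjes LIMSEQ_const_iff)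
qed

section \<open>Bounded integrands over \<open>(0, t]\<close>\<close>

lemma borel_measurable_restrict_Ioc_iff:
  fixes h :: "real \<Rightarrow> real"
  shows "h \<in> borel_measurable (restrict_space borel {0<..t})
    \<longleftrightarrow> (\<lambda>s. indicator {0<..t} s * h s) \<in> borel_measurable borel"
  by (subst borel_measurable_restrict_space_iff) simp_all

lemma cadlag_measurable_restrict:
  assumes "cadlag y" "0 < t"
  shows "y \<in> borel_measurable (restrict_space borel {0<..t})"
    and "left_lim y \<in> borel_measurable (restrict_space borel {0<..t})"
proof -
  have "continuous_on UNIV (\<lambda>z::real \<times> real. snd z)" "continuous_on UNIV (\<lambda>z::real \<times> real. fst z)"
    by (intro continuous_intros)+
  then show "y \<in> borel_measurable (restrict_space borel {0<..t})"
    "left_lim y \<in> borel_measurable (restrict_space borel {0<..t})"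
    unfolding borel_measurable_restrict_Ioc_iff
    using cadlag_measurable[OF assms, of "\<lambda>a b. b"] cadlag_measurable[OF assms, of "\<lambda>a b. a"]
    by simp_all
qed

context fv_path
begin

lemma ls_integrable_bounded:
  assumes "h \<in> borel_measurable (restrict_space borel {0<..t})" "\<And>s. 0 < s \<Longrightarrow> s \<le> t \<Longrightarrow> \<bar>h s\<bar> \<le> B"
  shows "ls_integrable g t h"
  unfolding ls_integrable_iff
proof (rule integrable_bounded)
  show "(\<lambda>s. indicator {0<..t} s * h s) \<in> borel_measurable borel"
    using assms(1) by (simp add: borel_measurable_restrict_Ioc_iff)
  show "\<bar>indicator {0<..t} s * h s\<bar> \<le> B * indicator {0<..t} s" for s
    using assms(2)[of s] by (auto simp: indicator_def)
qed

lemma ls_integral_diff: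
  assumes "ls_integrable g t h" "ls_integrable g t k"
  shows "ls_integral g t (\<lambda>s. h s - k s) = ls_integral g t h - ls_integral g t k"
  using stieltjes_diff[of "\<lambda>s. indicator {0<..t} s * h s" "\<lambda>s. indicator {0<..t} s * k s"] assms
  by (simp add: ls_integral_eq_stieltjes ls_integrable_iff right_diff_distrib)

lemma ls_integral_add:
  assumes "ls_integrable g t h" "ls_integrable g t k"
  shows "ls_integral g t (\<lambda>s. h s + k s) = ls_integral g t h + ls_integral g t k"
  using stieltjes_add[of "\<lambda>s. indicator {0<..t} s * h s" "\<lambda>s. indicator {0<..t} s * k s"] assms
  by (simp add: ls_integral_eq_stieltjes ls_integrable_iff distrib_left)

lemma abs_ls_integral_le:
  assumes "ls_integrable g t h" "ls_integrable g t k" "\<And>s. 0 < s \<Longrightarrow> s \<le> t \<Longrightarrow> \<bar>h s\<bar> \<le> k s"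
  shows "\<bar>ls_integral g t h\<bar> \<le> (\<integral>s. indicator {0<..t} s * k s \<partial>variation_measure g)"
proof -
  have "\<bar>ls_integral g t h\<bar> \<le> (\<integral>s. \<bar>indicator {0<..t} s * h s\<bar> \<partial>variation_measure g)"
    unfolding ls_integral_eq_stieltjes using assms(1) by (intro abs_stieltjes_le) (simp add: ls_integrable_iff)
  also have "\<dots> \<le> (\<integral>s. indicator {0<..t} s * k s \<partial>variation_measure g)"
    using assms by (intro integral_mono) (auto simp: ls_integrable_iff indicator_def)
  finally show ?thesis .
qed

lemma ls_integrable_subinterval:
  assumes "ls_integrable g t h" "b \<le> t"
  shows "integrable (variation_measure g) (\<lambda>s. indicator {a<..b} s * (indicator {0<..t} s * h s))"
  using integrable_mult_indicator[of "{a<..b}" "variation_measure g" "\<lambda>s. indicator {0<..t} s * h s"] assms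
  by (simp add: ls_integrable_iff)

lemma ls_integral_increment:
  assumes h: "ls_integrable g t h" and ab: "0 \<le> a" "a \<le> b" "b \<le> t"
  shows "ls_integral g b h - ls_integral g a h = stieltjes g (\<lambda>s. indicator {a<..b} s * (indicator {0<..t} s * h s))"
proof -
  note i = ls_integrable_subinterval[OF h]
  have "ls_integral g c h = stieltjes g (\<lambda>s. indicator {0<..c} s * (indicator {0<..t} s * h s))" if "c \<le> t" for c
    unfolding ls_integral_eq_stieltjes using that by (intro arg_cong[where f = "stieltjes g"]) (auto simp: indicator_def)
  moreover have "(\<lambda>s. indicator {0<..b} s * (indicator {0<..t} s * h s))
      = (\<lambda>s. indicator {0<..a} s * (indicator {0<..t} s * h s) + indicator {a<..b} s * (indicator {0<..t} s * h s))"
    using ab by (auto simp: indicator_def)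
  ultimately show ?thesis
    using ab stieltjes_add[OF i[of a 0] i[of b a]] by simp
qed

text \<open>Steps on intervals \<open>(a, b]\<close> turn the integral into increments of the indefinite integral of \<open>k\<close>.  With
  \<open>k = 1\<close> these are the increments of the integrator itself.\<close>

lemma ls_integral_step:
  assumes k: "ls_integrable g t k" and S: "\<And>c a b. (c, a, b) \<in> set S \<Longrightarrow> 0 \<le> a \<and> a \<le> b \<and> b \<le> t"
  shows "ls_integrable g t (\<lambda>s. (\<Sum>(c, a, b)\<leftarrow>S. c * indicator {a<..b} s) * k s)"
    and "ls_integral g t (\<lambda>s. (\<Sum>(c, a, b)\<leftarrow>S. c * indicator {a<..b} s) * k s)
      = (\<Sum>(c, a, b)\<leftarrow>S. c * (ls_integral g b k - ls_integral g a k))"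
  using S
proof (induction S)
  case Nil
  { case 1 then show ?case by (simp add: ls_integrable_iff) }
  { case 2 then show ?case by (simp add: ls_integral_eq_stieltjes stieltjes_def) }
next
  case (Cons z S)
  obtain c a b where z: "z = (c, a, b)" by (cases z)
  define u where "u s = c * (indicator {a<..b} s * k s)" for s
  define v where "v s = (\<Sum>(c, a, b)\<leftarrow>S. c * indicator {a<..b} s) * k s" for s
  have e: "(\<lambda>s. (\<Sum>(c, a, b)\<leftarrow>z # S. c * indicator {a<..b} s) * k s) = (\<lambda>s. u s + v s)"
    by (auto simp: z u_def v_def algebra_simps)
  have comm: "indicator {0<..t} s * u s = c * (indicator {a<..b} s * (indicator {0<..t} s * k s))" for s
    by (simp add: u_def)
  { case 1
    then have ab: "0 \<le> a \<and> a \<le> b \<and> b \<le> t" by (auto simp: z)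
    have "ls_integrable g t v" unfolding v_def by (rule Cons.IH) (use 1 in auto)
    moreover have "ls_integrable g t u"
      using ab ls_integrable_subinterval[OF k, of b a] by (simp add: ls_integrable_iff comm)
    ultimately show ?case unfolding e by (simp add: ls_integrable_iff distrib_left) }
  { case 2
    then have ab: "0 \<le> a \<and> a \<le> b \<and> b \<le> t" by (auto simp: z)
    have "ls_integrable g t v" unfolding v_def by (rule Cons.IH) (use 2 in auto)
    moreover have "ls_integrable g t u"
      using ab ls_integrable_subinterval[OF k, of b a] by (simp add: ls_integrable_iff comm)
    moreover have "ls_integral g t u = c * (ls_integral g b k - ls_integral g a k)"
      using ab by (simp add: ls_integral_increment[OF k] ls_integral_eq_stieltjes[of g t] comm stieltjes_cmult)
    moreover have "ls_integral g t v = (\<Sum>(c, a, b)\<leftarrow>S. c * (ls_integral g b k - ls_integral g a k))"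
      unfolding v_def by (rule Cons.IH) (use 2 in auto)
    ultimately show ?case unfolding e by (simp add: ls_integral_add z) }
qed

lemma ls_integral_one: "0 \<le> t \<Longrightarrow> ls_integral g t (\<lambda>_. 1) = g t - g 0"
  using stieltjes_indicator_Ioc[of 0 t] by (simp add: ls_integral_eq_stieltjes)

lemma integral_one: "0 \<le> t \<Longrightarrow> (\<integral>s. indicator {0<..t} s \<partial>variation_measure g) = V t"
  using measure_V_Ioc[of 0 t] total_variation_nonpos[of 0 g] by simp

lemma ls_integral_jumps:
  assumes "ls_integrable g t h" "countable J" "J \<subseteq> {0<..t}" "\<And>s. 0 < s \<Longrightarrow> s \<le> t \<Longrightarrow> s \<notin> J \<Longrightarrow> h s = 0"
  shows "((\<lambda>s. h s * jump g s) has_sum ls_integral g t h) J"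
proof -
  have "((\<lambda>s. indicator {0<..t} s * h s * jump g s) has_sum ls_integral g t h) J"
    unfolding ls_integral_eq_stieltjes
    using assms by (intro stieltjes_jumps) (auto simp: ls_integrable_iff indicator_def)
  then show ?thesis
    by (rule has_sum_cong[THEN iffD1, rotated]) (use assms(3) in auto)
qed

lemma integral_jumps:
  assumes "ls_integrable g t h" "countable J" "J \<subseteq> {0<..t}" "\<And>s. 0 < s \<Longrightarrow> s \<le> t \<Longrightarrow> s \<notin> J \<Longrightarrow> h s = 0"
  shows "((\<lambda>s. h s * \<bar>jump g s\<bar>) has_sum (\<integral>s. indicator {0<..t} s * h s \<partial>variation_measure g)) J"
proof -
  have "((\<lambda>s. indicator {0<..t} s * h s * \<bar>jump g s\<bar>) has_sum (\<integral>s. indicator {0<..t} s * h s \<partial>variation_measure g)) J"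
    using assms by (intro integral_variation_jumps) (auto simp: ls_integrable_iff indicator_def)
  then show ?thesis
    by (rule has_sum_cong[THEN iffD1, rotated]) (use assms(3) in auto)
qed

end

section \<open>Dominated sums, left limits and Taylor estimates\<close>

text \<open>Dominated convergence for sums over an arbitrary index set: the dominating
  function makes the convergence of the finite partial sums uniform in the parameter, so the two limits commute.\<close>

lemma tendsto_infsum_dominated:
  fixes a :: "'b \<Rightarrow> 'a \<Rightarrow> real"
  assumes G: "G \<noteq> bot" and dom: "\<forall>\<^sub>F e in G. \<forall>s\<in>J. \<bar>a e s\<bar> \<le> w s" and w: "w summable_on J"
    and lim: "\<And>s. s \<in> J \<Longrightarrow> ((\<lambda>e. a e s) \<longlongrightarrow> b s) G"
  shows "((\<lambda>e. \<Sum>\<^sub>\<infinity>s\<in>J. a e s) \<longlongrightarrow> (\<Sum>\<^sub>\<infinity>s\<in>J. b s)) G"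
proof (rule swap_uniform_limit')
  define Y where "Y = {e. \<forall>s\<in>J. \<bar>a e s\<bar> \<le> w s}"
  show "uniform_limit Y (\<lambda>X e. \<Sum>s\<in>X. a e s) (\<lambda>e. \<Sum>\<^sub>\<infinity>s\<in>J. a e s) (finite_subsets_at_top J)"
    by (rule Weierstrass_m_test_general[OF _ w]) (simp add: Y_def)
  show "\<forall>\<^sub>F e in G. e \<in> Y" using dom by (simp add: Y_def)
  show "\<forall>\<^sub>F X in finite_subsets_at_top J. ((\<lambda>e. \<Sum>s\<in>X. a e s) \<longlongrightarrow> (\<Sum>s\<in>X. b s)) G"
    by (rule eventually_finite_subsets_at_top_weakI, rule tendsto_sum, rule lim) blast
  have bw: "\<bar>b s\<bar> \<le> w s" if s: "s \<in> J" for s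
  proof (rule tendsto_upperbound[OF _ _ G])
    show "((\<lambda>e. \<bar>a e s\<bar>) \<longlongrightarrow> \<bar>b s\<bar>) G" by (rule tendsto_rabs[OF lim[OF s]])
    show "\<forall>\<^sub>F e in G. \<bar>a e s\<bar> \<le> w s" using dom by (rule eventually_mono) (use s in blast)
  qed
  have "(\<lambda>s. \<bar>b s\<bar>) summable_on J"
    by (rule summable_on_comparison_test[OF w]) (use bw in auto)
  then have "b summable_on J"
    using summable_on_iff_abs_summable_on_real[of b J] by simp
  then show "((\<lambda>X. \<Sum>s\<in>X. b s) \<longlongrightarrow> (\<Sum>\<^sub>\<infinity>s\<in>J. b s)) (finite_subsets_at_top J)"
    by (metis has_sum_infsum has_sum_def)
  show "finite_subsets_at_top J \<noteq> bot" by (rule finite_subsets_at_top_neq_bot)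
qed

lemma increasing_left_limit:
  fixes h :: "real \<Rightarrow> real"
  assumes "0 < t" "\<And>a b. 0 \<le> a \<Longrightarrow> a \<le> b \<Longrightarrow> b \<le> t \<Longrightarrow> h a \<le> h b"
  shows "\<exists>l. (h \<longlongrightarrow> l) (at_left t)"
proof
  define A where "A = h ` {0<..<t}"
  have A: "A \<noteq> {}" "bdd_above A"
  proof -
    show "A \<noteq> {}" using assms(1) by (simp add: A_def)
    show "bdd_above A" unfolding A_def
      by (rule bdd_aboveI2[of _ _ "h t"]) (rule assms(2), auto)
  qed
  have ev: "\<forall>\<^sub>F u in at_left t. 0 < u \<and> u < t"
    using assms(1) by (auto simp: eventually_at_left_field intro!: exI[of _ 0])
  show "(h \<longlongrightarrow> Sup A) (at_left t)"
  proof (rule order_tendstoI)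
    fix v assume "v < Sup A"
    then obtain u where u: "0 < u" "u < t" "v < h u"
      using less_cSupD[OF A(1), of v] by (auto simp: A_def)
    have "\<forall>\<^sub>F r in at_left t. u < r \<and> r < t"
      using u(2) by (auto simp: eventually_at_left_field intro!: exI[of _ u])
    then show "\<forall>\<^sub>F r in at_left t. v < h r"
    proof eventually_elim
      case (elim r)
      then have "h u \<le> h r" using u by (intro assms(2)) auto
      then show ?case using u(3) by linarith
    qed
  next
    fix v assume v: "Sup A < v"
    show "\<forall>\<^sub>F r in at_left t. h r < v"
      using ev
    proof eventually_elim
      case (elim r)
      then have "h r \<le> Sup A" by (intro cSup_upper A) (auto simp: A_def)
      then show ?case using v by linarith
    qed
  qed
qed

text \<open>A path of finite variation is the difference of the nondecreasing functions
  \<open>total_variation g + g\<close> and \<open>total_variation g\<close>.\<close>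

lemma finite_variation_left_limit:
  assumes "finite_variation g" "0 < t"
  shows "\<exists>l. (g \<longlongrightarrow> l) (at_left t)"
proof -
  have inc: "\<bar>g b - g a\<bar> \<le> total_variation g b - total_variation g a" if "0 \<le> a" "a \<le> b" for a b
    using abs_increment_le_total_variation_diff[OF assms(1) that] .
  obtain l where l: "((\<lambda>u. total_variation g u + g u) \<longlongrightarrow> l) (at_left t)"
  proof -
    have "total_variation g a + g a \<le> total_variation g b + g b" if "0 \<le> a" "a \<le> b" for a b
      using inc[OF that] by linarith
    then show ?thesis
      using increasing_left_limit[OF assms(2), of "\<lambda>u. total_variation g u + g u"] that by blast
  qed
  obtain m where m: "(total_variation g \<longlongrightarrow> m) (at_left t)"
    using increasing_left_limit[OF assms(2), of "total_variation g"] total_variation_mono[OF assms(1)]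
    by blast
  show ?thesis using tendsto_diff[OF l m] by auto
qed

lemma taylor_first_order:
  fixes f D :: "real \<Rightarrow> real"
  assumes f: "\<And>u. (f has_real_derivative D u) (at u)" and D: "continuous_on UNIV D" and e: "0 < e"
  obtains d where "0 < d"
    "\<And>a b. \<bar>a\<bar> \<le> B \<Longrightarrow> \<bar>b - a\<bar> < d \<Longrightarrow> \<bar>f b - f a - D a * (b - a)\<bar> \<le> e * \<bar>b - a\<bar>"
proof -
  \<comment> \<open>The margin of length 1 leaves room for \<open>b\<close>, which may lie outside \<open>[-B, B]\<close>.\<close>
  have "uniformly_continuous_on {-B-1..B+1} D"
    by (intro compact_uniformly_continuous continuous_on_subset[OF D]) auto
  then obtain d where d: "0 < d"
    "\<And>u v. u \<in> {-B-1..B+1} \<Longrightarrow> v \<in> {-B-1..B+1} \<Longrightarrow> \<bar>v - u\<bar> < d \<Longrightarrow> \<bar>D v - D u\<bar> < e"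
    using e unfolding uniformly_continuous_on_def dist_real_def by metis
  show ?thesis
  proof (rule that[of "min d 1"])
    fix a b assume ab: "\<bar>a\<bar> \<le> B" "\<bar>b - a\<bar> < min d 1"
    obtain z where z: "divided_difference f D a b = D z" "min a b \<le> z" "z \<le> max a b"
      using divided_difference_mean_value[OF f] by metis
    have "f b - f a - D a * (b - a) = (D z - D a) * (b - a)"
      using divided_difference_mult[of f D a b] z(1) by (simp add: algebra_simps)
    moreover have "\<bar>D z - D a\<bar> \<le> e"
    proof -
      have "\<bar>a\<bar> \<le> B" "\<bar>z\<bar> \<le> B + 1" "\<bar>z - a\<bar> < d" using z(2,3) ab by linarith+
      then have "a \<in> {-B-1..B+1}" "z \<in> {-B-1..B+1}" by auto
      then show ?thesis using d(2) \<open>\<bar>z - a\<bar> < d\<close> by (simp add: less_imp_le)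
    qed
    ultimately show "\<bar>f b - f a - D a * (b - a)\<bar> \<le> e * \<bar>b - a\<bar>"
      by (simp add: abs_mult mult_right_mono)
  qed (use d in auto)
qed

lemma taylor_second_order:
  fixes f F D :: "real \<Rightarrow> real"
  assumes F: "\<And>u. (F has_real_derivative f u) (at u)" and f: "\<And>u. (f has_real_derivative D u) (at u)"
    and C: "\<And>u. \<bar>u\<bar> \<le> B \<Longrightarrow> \<bar>D u\<bar> \<le> C" and ab: "\<bar>a\<bar> \<le> B" "\<bar>b\<bar> \<le> B"
  shows "\<bar>F b - F a - f a * (b - a)\<bar> \<le> C * (b - a)\<^sup>2"
proof -
  obtain z where z: "divided_difference F f a b = f z" "min a b \<le> z" "z \<le> max a b"
    using divided_difference_mean_value[OF F] by metis
  have zB: "\<bar>z\<bar> \<le> B" using z ab by linarith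
  have C0: "0 \<le> C" using C[of a] ab by linarith
  have "F b - F a - f a * (b - a) = (f z - f a) * (b - a)"
    using divided_difference_mult[of F f a b] z(1) by (simp add: algebra_simps)
  also have "f z - f a = divided_difference f D a z * (z - a)" by (simp add: divided_difference_mult)
  finally have "\<bar>F b - F a - f a * (b - a)\<bar> = \<bar>divided_difference f D a z\<bar> * (\<bar>z - a\<bar> * \<bar>b - a\<bar>)"
    by (simp add: abs_mult)
  also have "\<dots> \<le> C * (\<bar>b - a\<bar> * \<bar>b - a\<bar>)"
  proof (intro mult_mono)
    show "\<bar>divided_difference f D a z\<bar> \<le> C" by (rule divided_difference_bounded[OF f C ab(1) zB])
    show "\<bar>z - a\<bar> \<le> \<bar>b - a\<bar>" using z(2,3) by linarith
  qed (use C0 in auto)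
  finally show ?thesis by (simp add: power2_eq_square)
qed

section \<open>Approximations of a path by paths of finite variation\<close>

locale path_approximation =
  fixes x :: "real \<Rightarrow> real" and X :: "real \<Rightarrow> real \<Rightarrow> real" and Q :: "real \<Rightarrow> real" and K :: real
  assumes cadlag_x: "cadlag x"
    and jumps_square_summable: "\<And>t. t > 0 \<Longrightarrow> (\<lambda>s. (jump x s)\<^sup>2) summable_on {0<..t}"
    and cadlag_X: "\<And>e. e > 0 \<Longrightarrow> cadlag (X e)"
    and close: "\<And>e s. e > 0 \<Longrightarrow> s \<ge> 0 \<Longrightarrow> \<bar>x s - X e s\<bar> \<le> e"
    and fv_X: "\<And>e. e > 0 \<Longrightarrow> finite_variation (X e)"
    and limit_Q: "\<And>T. T \<ge> 0 \<Longrightarrow>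
           uniform_limit {0..T} (\<lambda>e t. 2 * ls_integral (X e) t (\<lambda>s. x s - X e s)) Q (at_right 0)"
    and bound: "\<And>t. t > 0 \<Longrightarrow>
           (SUP e\<in>{0<..}. \<integral>\<^sup>+s\<in>{0<..t}. ennreal \<bar>x s - X e s\<bar> \<partial>variation_measure (X e)) < \<infinity>"
    and jump_X: "\<And>e t. e > 0 \<Longrightarrow> t > 0 \<Longrightarrow> \<bar>jump (X e) t\<bar> \<le> K * \<bar>jump x t\<bar>"
begin

lemma fv_path_X: "0 < e \<Longrightarrow> fv_path (X e)"
  using cadlag_X fv_X by (simp add: fv_path_def)

lemma measurable_paths:
  assumes "0 < t" "0 < e"
  shows "x \<in> borel_measurable (restrict_space borel {0<..t})"
    "left_lim x \<in> borel_measurable (restrict_space borel {0<..t})"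
    "X e \<in> borel_measurable (restrict_space borel {0<..t})"
    "left_lim (X e) \<in> borel_measurable (restrict_space borel {0<..t})"
  using cadlag_measurable_restrict[OF cadlag_x assms(1)]
    cadlag_measurable_restrict[OF cadlag_X[OF assms(2)] assms(1)] by auto

lemma error_integrable:
  assumes "0 < t" "0 < e"
  shows "ls_integrable (X e) t (\<lambda>s. x s - X e s)" "ls_integrable (X e) t (\<lambda>s. \<bar>x s - X e s\<bar>)"
proof -
  note [measurable] = measurable_paths[OF assms]
  show "ls_integrable (X e) t (\<lambda>s. x s - X e s)"
    by (rule fv_path.ls_integrable_bounded[OF fv_path_X[OF assms(2)], where B = e]) (auto simp: close assms)
  show "ls_integrable (X e) t (\<lambda>s. \<bar>x s - X e s\<bar>)"
    by (rule fv_path.ls_integrable_bounded[OF fv_path_X[OF assms(2)], where B = e]) (auto simp: close assms)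
qed

definition error_mass :: "real \<Rightarrow> real \<Rightarrow> real" where
  "error_mass e t = (\<integral>s. indicator {0<..t} s * \<bar>x s - X e s\<bar> \<partial>variation_measure (X e))"

text \<open>The hypothesis on the supremum enters only through this bound, which is uniform in the
  approximation parameter.\<close>

lemma error_mass_bounded:
  assumes "0 < t"
  obtains M where "0 \<le> M" "\<And>e. 0 < e \<Longrightarrow> error_mass e t \<le> M"
proof -
  define S where "S = (SUP e\<in>{0<..}. \<integral>\<^sup>+s\<in>{0<..t}. ennreal \<bar>x s - X e s\<bar> \<partial>variation_measure (X e))"
  show ?thesis
  proof (rule that[of "enn2real S"])
    fix e :: real assume e: "0 < e"
    have "ennreal (error_mass e t) = (\<integral>\<^sup>+s. ennreal (indicator {0<..t} s * \<bar>x s - X e s\<bar>) \<partial>variation_measure (X e))"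
      unfolding error_mass_def using error_integrable(2)[OF assms e]
      by (intro nn_integral_eq_integral[symmetric]) (auto simp: ls_integrable_iff)
    also have "\<dots> = (\<integral>\<^sup>+s\<in>{0<..t}. ennreal \<bar>x s - X e s\<bar> \<partial>variation_measure (X e))"
      by (intro nn_integral_cong) (auto simp: indicator_def)
    also have "\<dots> \<le> S" unfolding S_def using e by (intro SUP_upper) auto
    also have "S = ennreal (enn2real S)" using bound[OF assms] by (simp add: S_def)
    finally show "error_mass e t \<le> enn2real S" by (simp add: ennreal_le_iff)
  qed simp
qed

text \<open>The two bounds serve different purposes.  The one by \<open>error_mass\<close> is uniform in \<open>e\<close> and telescopes, which
  gives finite variation of the limit.  The one by the variation of \<open>X e\<close> is not uniform in \<open>e\<close>, but it
  tends to zero as \<open>b\<close> decreases to \<open>a\<close>, which gives right continuity.\<close>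

lemma error_increment_le_mass:
  assumes e: "0 < e" and ab: "0 \<le> a" "a \<le> b" and T: "b \<le> T" "0 < T"
  shows "\<bar>ls_integral (X e) b (\<lambda>s. x s - X e s) - ls_integral (X e) a (\<lambda>s. x s - X e s)\<bar>
      \<le> error_mass e b - error_mass e a" (is ?mass)
    and "\<bar>ls_integral (X e) b (\<lambda>s. x s - X e s) - ls_integral (X e) a (\<lambda>s. x s - X e s)\<bar>
      \<le> e * (total_variation (X e) b - total_variation (X e) a)" (is ?var)
proof -
  interpret y: fv_path "X e" by (rule fv_path_X[OF e])
  let ?h = "\<lambda>s. x s - X e s"
  note i = error_integrable[OF T(2) e]
  have abs: "\<bar>indicator {a<..b} s * (indicator {0<..T} s * ?h s)\<bar> = indicator {a<..b} s * (indicator {0<..T} s * \<bar>?h s\<bar>)" for s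
    by (simp add: abs_mult)
  have le: "\<bar>ls_integral (X e) b ?h - ls_integral (X e) a ?h\<bar>
      \<le> (\<integral>s. indicator {a<..b} s * (indicator {0<..T} s * \<bar>?h s\<bar>) \<partial>variation_measure (X e))"
    unfolding y.ls_integral_increment[OF i(1) ab T(1)] abs[symmetric]
    by (intro y.abs_stieltjes_le y.ls_integrable_subinterval i T)
  have m: "error_mass e c = (\<integral>s. indicator {0<..c} s * (indicator {0<..T} s * \<bar>?h s\<bar>) \<partial>variation_measure (X e))" if "c \<le> T" for c
    unfolding error_mass_def using that by (intro Bochner_Integration.integral_cong) (auto simp: indicator_def)
  have "error_mass e b = (\<integral>s. indicator {0<..a} s * (indicator {0<..T} s * \<bar>?h s\<bar>)
      + indicator {a<..b} s * (indicator {0<..T} s * \<bar>?h s\<bar>) \<partial>variation_measure (X e))"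
    unfolding m[OF T(1)] using ab by (intro Bochner_Integration.integral_cong) (auto simp: indicator_def)
  also have "\<dots> = error_mass e a + (\<integral>s. indicator {a<..b} s * (indicator {0<..T} s * \<bar>?h s\<bar>) \<partial>variation_measure (X e))"
    using ab T by (subst Bochner_Integration.integral_add) (auto intro!: y.ls_integrable_subinterval i simp: m)
  finally show ?mass using le by linarith
  have "(\<integral>s. indicator {a<..b} s * (indicator {0<..T} s * \<bar>?h s\<bar>) \<partial>variation_measure (X e))
      \<le> (\<integral>s. e * indicator {a<..b} s \<partial>variation_measure (X e))"
  proof (rule integral_mono)
    show "integrable (variation_measure (X e)) (\<lambda>s. e * indicator {a<..b} s)"
      by (intro integrable_mult_right y.integrable_indicator_Ioc)
    show "indicator {a<..b} s * (indicator {0<..T} s * \<bar>?h s\<bar>) \<le> e * indicator {a<..b} s" for s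
      using close[OF e, of s] ab e by (auto simp: indicator_def)
  qed (intro y.ls_integrable_subinterval i T)
  also have "\<dots> = e * (total_variation (X e) b - total_variation (X e) a)"
    using y.measure_V_Ioc[OF ab(2)] by simp
  finally show ?var using le by linarith
qed

lemma limit_Q_pointwise:
  assumes "0 \<le> u"
  shows "((\<lambda>e. 2 * ls_integral (X e) u (\<lambda>s. x s - X e s)) \<longlongrightarrow> Q u) (at_right 0)"
  using tendsto_uniform_limitI[OF limit_Q[OF assms], of u] assms by simp

lemma eventually_pos: "\<forall>\<^sub>F e in at_right (0::real). 0 < e"
  by (simp add: eventually_at_right_less)

lemma finite_variation_Q: "finite_variation Q"
  unfolding finite_variation_def
proof (intro allI impI)
  fix t :: real assume "0 \<le> t"
  obtain M where M: "\<And>e. 0 < e \<Longrightarrow> error_mass e (t + 1) \<le> M"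
    using error_mass_bounded[of "t + 1"] \<open>0 \<le> t\<close> by auto
  let ?A = "\<lambda>e u. ls_integral (X e) u (\<lambda>s. x s - X e s)"
  show "bdd_above (variation_sums Q t)"
    unfolding variation_sums_altdef
  proof (rule bdd_aboveI)
    fix v assume "v \<in> {partition_sum Q p n |n p. incseq p \<and> range p \<subseteq> {0..t}}"
    then obtain n p where v: "v = partition_sum Q p n" and p: "incseq p" "range p \<subseteq> {0..t}" by auto
    have pt: "0 \<le> p i" "p i \<le> t" "p i \<le> p (Suc i)" for i
      using subsetD[OF p(2) rangeI, of i] incseq_SucD[OF p(1), of i] by auto
    show "v \<le> 2 * M"
    proof (rule tendsto_upperbound)
      show "((\<lambda>e. partition_sum (\<lambda>u. 2 * ?A e u) p n) \<longlongrightarrow> v) (at_right 0)"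
        unfolding v partition_sum_def
        by (intro tendsto_sum tendsto_rabs tendsto_diff limit_Q_pointwise pt)
      show "\<forall>\<^sub>F e in at_right 0. partition_sum (\<lambda>u. 2 * ?A e u) p n \<le> 2 * M"
        using eventually_pos
      proof eventually_elim
        case (elim e)
        have "partition_sum (\<lambda>u. 2 * ?A e u) p n \<le> (\<Sum>i<n. 2 * error_mass e (p (Suc i)) - 2 * error_mass e (p i))"
          unfolding partition_sum_def
        proof (rule sum_mono)
          fix i
          have "p (Suc i) \<le> t + 1" using pt(2)[of "Suc i"] by simp
          then show "\<bar>2 * ?A e (p (Suc i)) - 2 * ?A e (p i)\<bar> \<le> 2 * error_mass e (p (Suc i)) - 2 * error_mass e (p i)"
            using error_increment_le_mass(1)[OF elim pt(1)[of i] pt(3)[of i], of "t + 1"] \<open>0 \<le> t\<close> by linarith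
        qed
        also have "\<dots> = 2 * error_mass e (p n) - 2 * error_mass e (p 0)"
          by (rule sum_lessThan_telescope)
        also have "\<dots> \<le> 2 * M"
        proof -
          have "p n \<le> t + 1" using pt(2)[of n] by simp
          then have "error_mass e (p n) \<le> error_mass e (t + 1)"
            using error_increment_le_mass(1)[OF elim pt(1)[of n], of "t + 1" "t + 1"] \<open>0 \<le> t\<close> by linarith
          moreover have "0 \<le> error_mass e (p 0)" by (simp add: error_mass_def)
          ultimately show ?thesis using M[OF elim] by linarith
        qed
        finally show ?case .
      qed
    qed simp
  qed
qed

text \<open>Right continuity is inherited under uniform convergence, and left limits exist because \<open>Q\<close> has finite
  variation.\<close>

lemma cadlag_Q: "cadlag Q"
  unfolding cadlag_def
proof (intro conjI allI impI)
  show "\<exists>l. (Q \<longlongrightarrow> l) (at_left t)" if "0 < t" for t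
    by (rule finite_variation_left_limit[OF finite_variation_Q that])
  fix t :: real assume t: "0 \<le> t"
  let ?A = "\<lambda>e u. ls_integral (X e) u (\<lambda>s. x s - X e s)"
  have "(Q \<longlongrightarrow> Q t) (at_right t)"
  proof (rule tendstoI)
    fix r :: real assume r: "0 < r"
    have "\<forall>\<^sub>F e in at_right 0. \<forall>u\<in>{0..t+1}. dist (2 * ?A e u) (Q u) < r/4"
      using uniform_limitD[OF limit_Q[of "t + 1"], of "r/4"] t r by simp
    then have "\<forall>\<^sub>F e in at_right 0. 0 < e \<and> (\<forall>u\<in>{0..t+1}. dist (2 * ?A e u) (Q u) < r/4)"
      using eventually_pos by eventually_elim auto
    then obtain e where e: "0 < e" "\<And>u. u \<in> {0..t+1} \<Longrightarrow> dist (2 * ?A e u) (Q u) < r/4"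
      using eventually_happens'[OF trivial_limit_at_right_real] by blast
    interpret y: fv_path "X e" by (rule fv_path_X[OF e(1)])
    have "(total_variation (X e) \<longlongrightarrow> total_variation (X e) t) (at_right t)"
      using y.V_right[of t] by (simp add: continuous_within)
    then have "((\<lambda>u. 2 * (e * (total_variation (X e) u - total_variation (X e) t)))
        \<longlongrightarrow> 2 * (e * (total_variation (X e) t - total_variation (X e) t))) (at_right t)"
      by (intro tendsto_intros)
    then have "\<forall>\<^sub>F u in at_right t. 2 * (e * (total_variation (X e) u - total_variation (X e) t)) < r/2"
      using r by (intro order_tendstoD(2)) auto
    moreover have "\<forall>\<^sub>F u in at_right t. t < u \<and> u < t + 1"
      by (auto simp: eventually_at_right_field intro!: exI[of _ "t + 1"])
    ultimately show "\<forall>\<^sub>F u in at_right t. dist (Q u) (Q t) < r"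
    proof eventually_elim
      case (elim u)
      have "\<bar>?A e u - ?A e t\<bar> \<le> e * (total_variation (X e) u - total_variation (X e) t)"
        using elim t by (intro error_increment_le_mass(2)[OF e(1), of t u "t + 1"]) auto
      moreover have "dist (2 * ?A e u) (Q u) < r/4" "dist (2 * ?A e t) (Q t) < r/4"
        using elim t by (auto intro!: e(2) simp del: less_divide_eq_numeral1)
      ultimately show ?case using elim(1) unfolding dist_real_def by linarith
    qed
  qed
  then show "continuous (at_right t) Q" by (simp add: continuous_within)
qed

lemma fv_path_Q: "fv_path Q"
  using cadlag_Q finite_variation_Q by (simp add: fv_path_def)

text \<open>On steps this is the definition of \<open>Q\<close>.  A left continuous integrand with right limits is
  uniformly close to a step function, and the total masses of the measures \<open>(x - X e) dX e\<close> are
  bounded, so the error of the approximation is small uniformly in \<open>e\<close>.\<close>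

lemma weighted_error_limit:
  assumes t: "0 < t" and l: "\<And>s. 0 < s \<Longrightarrow> (h \<longlongrightarrow> h s) (at_left s)"
    and r: "\<And>s. 0 \<le> s \<Longrightarrow> \<exists>m. (h \<longlongrightarrow> m) (at_right s)"
    and m [measurable]: "h \<in> borel_measurable (restrict_space borel {0<..t})"
    and C: "\<And>s. 0 < s \<Longrightarrow> s \<le> t \<Longrightarrow> \<bar>h s\<bar> \<le> C"
  shows "((\<lambda>e. ls_integral (X e) t (\<lambda>s. h s * (x s - X e s))) \<longlongrightarrow> 1/2 * ls_integral Q t h) (at_right 0)"
proof (rule tendstoI)
  fix w :: real assume w: "0 < w"
  interpret q: fv_path Q by (rule fv_path_Q)
  let ?A = "\<lambda>e u. ls_integral (X e) u (\<lambda>s. x s - X e s)"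
  obtain M where M: "0 \<le> M" "\<And>e. 0 < e \<Longrightarrow> error_mass e t \<le> M" using error_mass_bounded[OF t] by blast
  have V0: "0 \<le> total_variation Q t"
    using q.V_mono[of 0 t] total_variation_nonpos[of 0 Q] t by simp
  \<comment> \<open>A step function within \<open>d\<close> of \<open>h\<close> costs at most \<open>d * M\<close> for each \<open>X e\<close> and \<open>d * total_variation Q t\<close> for \<open>Q\<close>.\<close>
  define d where "d = w / (4 * (M + total_variation Q t + 1))"
  have d: "0 < d" using w M V0 by (simp add: d_def)
  have dM: "d * M \<le> w/4" "d * total_variation Q t \<le> w/4"
    using w M V0 by (auto simp: d_def field_simps mult_nonneg_nonneg)
  obtain S where S: "\<And>c a b. (c, a, b) \<in> set S \<Longrightarrow> 0 \<le> a \<and> a \<le> b \<and> b \<le> t"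
    and hS: "\<And>s. 0 < s \<Longrightarrow> s \<le> t \<Longrightarrow> \<bar>h s - (\<Sum>(c, a, b)\<leftarrow>S. c * indicator {a<..b} s)\<bar> \<le> d"
    using caglad_step_approximation[of h t d, OF l r less_imp_le[OF t] d] by metis
  define k where "k s = (\<Sum>(c, a, b)\<leftarrow>S. c * (indicator {a<..b} s :: real))" for s :: real
  have hi: "ls_integrable Q t h" by (rule q.ls_integrable_bounded[OF m C])
  have one: "ls_integrable Q t (\<lambda>_. 1)" by (rule q.ls_integrable_bounded[where B = 1]) auto
  have ki: "ls_integrable Q t k"
    using q.ls_integral_step(1)[OF one S] by (simp add: k_def[abs_def])
  have kQ: "ls_integral Q t k = (\<Sum>(c, a, b)\<leftarrow>S. c * (Q b - Q a))"
  proof -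
    have "ls_integral Q t k = (\<Sum>(c, a, b)\<leftarrow>S. c * (ls_integral Q b (\<lambda>_. 1) - ls_integral Q a (\<lambda>_. 1)))"
      using q.ls_integral_step(2)[OF one S] by (simp add: k_def[abs_def])
    also have "\<dots> = (\<Sum>(c, a, b)\<leftarrow>S. c * (Q b - Q a))"
      using S by (intro arg_cong[where f = sum_list] map_cong) (force simp: q.ls_integral_one)+
    finally show ?thesis .
  qed
  have errQ: "\<bar>ls_integral Q t h - ls_integral Q t k\<bar> \<le> w/4"
  proof -
    have "\<bar>ls_integral Q t (\<lambda>s. h s - k s)\<bar> \<le> (\<integral>s. indicator {0<..t} s * d \<partial>variation_measure Q)"
    proof (rule q.abs_ls_integral_le)
      show "ls_integrable Q t (\<lambda>s. h s - k s)"
        using hi ki by (simp add: ls_integrable_iff right_diff_distrib)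
      show "ls_integrable Q t (\<lambda>_. d)" by (rule q.ls_integrable_bounded[where B = d]) (use d in auto)
    qed (use hS in \<open>simp add: k_def\<close>)
    also have "\<dots> = d * total_variation Q t" using q.integral_one[of t] t by (simp add: mult.commute)
    finally show ?thesis using dM(2) q.ls_integral_diff[OF hi ki] by linarith
  qed
  have errX: "\<bar>ls_integral (X e) t (\<lambda>s. h s * (x s - X e s)) - (\<Sum>(c, a, b)\<leftarrow>S. c * (?A e b - ?A e a))\<bar> \<le> w/4"
    if e: "0 < e" for e
  proof -
    interpret y: fv_path "X e" by (rule fv_path_X[OF e])
    note [measurable] = measurable_paths[OF t e]
    have hx: "ls_integrable (X e) t (\<lambda>s. h s * (x s - X e s))"
    proof (rule y.ls_integrable_bounded)
      show "\<bar>h s * (x s - X e s)\<bar> \<le> C * e" if "0 < s" "s \<le> t" for s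
        unfolding abs_mult using that C[OF that] close[OF e, of s] by (intro mult_mono) auto
    qed measurable
    have kx: "ls_integrable (X e) t (\<lambda>s. k s * (x s - X e s))"
      "ls_integral (X e) t (\<lambda>s. k s * (x s - X e s)) = (\<Sum>(c, a, b)\<leftarrow>S. c * (?A e b - ?A e a))"
      unfolding k_def by (rule y.ls_integral_step[OF error_integrable(1)[OF t e] S], assumption)+
    have "\<bar>ls_integral (X e) t (\<lambda>s. h s * (x s - X e s) - k s * (x s - X e s))\<bar>
        \<le> (\<integral>s. indicator {0<..t} s * (d * \<bar>x s - X e s\<bar>) \<partial>variation_measure (X e))"
    proof (rule y.abs_ls_integral_le)
      show "ls_integrable (X e) t (\<lambda>s. h s * (x s - X e s) - k s * (x s - X e s))"
        using hx kx(1) by (simp add: ls_integrable_iff right_diff_distrib)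
      show "ls_integrable (X e) t (\<lambda>s. d * \<bar>x s - X e s\<bar>)"
        using error_integrable(2)[OF t e] by (simp add: ls_integrable_iff mult.left_commute)
      show "\<bar>h s * (x s - X e s) - k s * (x s - X e s)\<bar> \<le> d * \<bar>x s - X e s\<bar>" if "0 < s" "s \<le> t" for s
        using hS[OF that] by (simp add: k_def left_diff_distrib[symmetric] abs_mult mult_right_mono)
    qed
    also have "\<dots> = d * error_mass e t" by (simp add: error_mass_def mult.left_commute)
    also have "\<dots> \<le> w/4" using M(2)[OF e] d dM(1) by (meson mult_left_mono less_imp_le order_trans)
    finally show ?thesis using y.ls_integral_diff[OF hx kx(1)] kx(2) by simp
  qed
  have lim: "((\<lambda>e. \<Sum>(c, a, b)\<leftarrow>S. c * (?A e b - ?A e a)) \<longlongrightarrow> (\<Sum>(c, a, b)\<leftarrow>S. c * (1/2 * Q b - 1/2 * Q a))) (at_right 0)"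
    using S
  proof (induction S)
    case (Cons z S)
    obtain c a b where z: "z = (c, a, b)" by (cases z)
    have ab: "0 \<le> a" "0 \<le> b" using Cons.prems[of c a b] by (auto simp: z)
    have half: "((\<lambda>e. ?A e u) \<longlongrightarrow> 1/2 * Q u) (at_right 0)" if "0 \<le> u" for u
      using tendsto_mult[OF tendsto_const[of "1/2"] limit_Q_pointwise[OF that]] by simp
    have "((\<lambda>e. \<Sum>(c, a, b)\<leftarrow>S. c * (?A e b - ?A e a)) \<longlongrightarrow> (\<Sum>(c, a, b)\<leftarrow>S. c * (1/2 * Q b - 1/2 * Q a))) (at_right 0)"
      by (rule Cons.IH) (use Cons.prems in auto)
    then show ?case unfolding z list.map sum_list.Cons prod.case
      by (intro tendsto_add tendsto_mult tendsto_diff tendsto_const half ab)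
  qed simp
  have eq: "(\<Sum>(c, a, b)\<leftarrow>S. c * (1/2 * Q b - 1/2 * Q a)) = 1/2 * ls_integral Q t k"
    unfolding kQ by (induction S) (auto simp: field_simps)
  have "\<forall>\<^sub>F e in at_right 0. dist (\<Sum>(c, a, b)\<leftarrow>S. c * (?A e b - ?A e a)) (1/2 * ls_integral Q t k) < w/4"
    using tendstoD[OF lim, of "w/4"] w unfolding eq by simp
  then show "\<forall>\<^sub>F e in at_right 0. dist (ls_integral (X e) t (\<lambda>s. h s * (x s - X e s))) (1/2 * ls_integral Q t h) < w"
    using eventually_pos
  proof eventually_elim
    case (elim e)
    then show ?case using errX[OF elim(2)] errQ w unfolding dist_real_def by linarith
  qed
qed

end

section \<open>The Ito formula\<close>

locale ito_setting = path_approximation +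
  fixes f D F :: "real \<Rightarrow> real" and t :: real
  assumes f: "\<And>u. (f has_real_derivative D u) (at u)" and D: "continuous_on UNIV D"
    and F: "\<And>u. (F has_real_derivative f u) (at u)" and t: "0 < t"
begin

lemma continuous_f: "continuous_on UNIV f"
  using f DERIV_isCont by (auto simp: continuous_on_eq_continuous_at)

lemma path_bound:
  obtains B where "0 \<le> B" "\<forall>s. 0 \<le> s \<longrightarrow> s \<le> t \<longrightarrow> \<bar>x s\<bar> \<le> B"
  using cadlag_bounded[OF cadlag_x less_imp_le[OF t]] by blast

lemma path_bounds:
  assumes "\<forall>s. 0 \<le> s \<longrightarrow> s \<le> t \<longrightarrow> \<bar>x s\<bar> \<le> B"
  shows "0 < s \<Longrightarrow> s \<le> t \<Longrightarrow> \<bar>left_lim x s\<bar> \<le> B"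
    and "0 < e \<Longrightarrow> 0 \<le> s \<Longrightarrow> s \<le> t \<Longrightarrow> \<bar>X e s\<bar> \<le> B + e"
    and "0 < e \<Longrightarrow> 0 < s \<Longrightarrow> s \<le> t \<Longrightarrow> \<bar>left_lim (X e) s\<bar> \<le> B + e"
proof -
  note B = assms[rule_format]
  have X: "\<bar>X e s\<bar> \<le> B + e" if "0 < e" "0 \<le> s" "s \<le> t" for e s
    using B[OF that(2,3)] close[OF that(1,2)] by linarith
  show "0 < s \<Longrightarrow> s \<le> t \<Longrightarrow> \<bar>left_lim x s\<bar> \<le> B" by (rule left_lim_bounded[OF cadlag_x _ _ B])
  show "0 < e \<Longrightarrow> 0 \<le> s \<Longrightarrow> s \<le> t \<Longrightarrow> \<bar>X e s\<bar> \<le> B + e" by (rule X)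
  show "0 < e \<Longrightarrow> 0 < s \<Longrightarrow> s \<le> t \<Longrightarrow> \<bar>left_lim (X e) s\<bar> \<le> B + e"
    by (rule left_lim_bounded[OF cadlag_X _ _ X])
qed

lemma left_lim_close: "0 < e \<Longrightarrow> 0 < s \<Longrightarrow> \<bar>left_lim x s - left_lim (X e) s\<bar> \<le> e"
  by (rule left_lim_dist[OF cadlag_x cadlag_X]) (auto intro: close)

definition jump_times :: "real set" where
  "jump_times = {s \<in> {0<..t}. jump x s \<noteq> 0}"

lemma jump_times: "countable jump_times" "jump_times \<subseteq> {0<..t}"
proof -
  have "countable {s \<in> {0<..t}. (jump x s)\<^sup>2 \<noteq> 0}"
    by (rule summable_countable_real[OF jumps_square_summable[OF t]])
  then show "countable jump_times" by (simp add: jump_times_def)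
  show "jump_times \<subseteq> {0<..t}" by (auto simp: jump_times_def)
qed

lemma squares_on_jump_times: "(\<lambda>s. (jump x s)\<^sup>2) summable_on jump_times"
  by (rule summable_on_subset_banach[OF jumps_square_summable[OF t] jump_times(2)])

lemma jump_X_bound: "0 < e \<Longrightarrow> 0 < s \<Longrightarrow> \<bar>jump (X e) s\<bar> \<le> \<bar>K\<bar> * \<bar>jump x s\<bar>"
  using jump_X[of e s] mult_right_mono[of K "\<bar>K\<bar>" "\<bar>jump x s\<bar>"] abs_ge_self[of K] by linarith

lemma jump_X_zero: "0 < e \<Longrightarrow> s \<in> {0<..t} \<Longrightarrow> s \<notin> jump_times \<Longrightarrow> jump (X e) s = 0 \<and> jump x s = 0"
  using jump_X[of e s] by (auto simp: jump_times_def)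

text \<open>Products of jumps of \<open>X e\<close> and \<open>x\<close> are dominated by the summable squares of the jumps of \<open>x\<close>,
  with a constant that does not depend on \<open>e\<close>.\<close>

lemma jump_error_bound:
  assumes "0 < e" "0 < s"
  shows "\<bar>jump (X e) s - jump x s\<bar> * \<bar>jump (X e) s\<bar> \<le> (\<bar>K\<bar> + 1) * \<bar>K\<bar> * (jump x s)\<^sup>2"
proof -
  have "\<bar>jump (X e) s - jump x s\<bar> \<le> (\<bar>K\<bar> + 1) * \<bar>jump x s\<bar>"
    using jump_X_bound[OF assms] by (simp add: distrib_right)
  then have "\<bar>jump (X e) s - jump x s\<bar> * \<bar>jump (X e) s\<bar> \<le> ((\<bar>K\<bar> + 1) * \<bar>jump x s\<bar>) * (\<bar>K\<bar> * \<bar>jump x s\<bar>)"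
    by (intro mult_mono jump_X_bound assms) auto
  also have "\<dots> = (\<bar>K\<bar> + 1) * \<bar>K\<bar> * (jump x s)\<^sup>2"
    by (simp add: power2_eq_square)
  finally show ?thesis .
qed

text \<open>The first order expansion is taken at the left limits and not at the values of the paths: at a
  common jump \<open>f (X e s) - f (left_lim x s)\<close> is not small, while the left limits stay within \<open>e\<close> of each
  other at every time.\<close>

definition taylor_error :: "real \<Rightarrow> real \<Rightarrow> real" where
  "taylor_error e s = f (left_lim (X e) s) - f (left_lim x s)
     - D (left_lim x s) * (left_lim (X e) s - left_lim x s)"

text \<open>What is left of the integrand after \<open>taylor_error\<close>.  The term with \<open>D\<close> accounts for the
  difference between \<open>x s - X e s\<close>, whose integral converges, and the difference of the left limits.\<close>

definition jump_error :: "real \<Rightarrow> real \<Rightarrow> real" where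
  "jump_error e s = divided_difference F f (left_lim (X e) s) (X e s) - f (left_lim (X e) s)
     - D (left_lim x s) * (jump (X e) s - jump x s)"

definition jump_term :: "real \<Rightarrow> real" where
  "jump_term s = F (x s) - F (left_lim x s) - f (left_lim x s) * jump x s"

lemma measurable_integrands:
  assumes "0 < e"
  shows "(\<lambda>s. f (left_lim x s)) \<in> borel_measurable (restrict_space borel {0<..t})"
    "(\<lambda>s. D (left_lim x s)) \<in> borel_measurable (restrict_space borel {0<..t})"
    "taylor_error e \<in> borel_measurable (restrict_space borel {0<..t})"
    "(\<lambda>s. divided_difference F f (left_lim (X e) s) (X e s)) \<in> borel_measurable (restrict_space borel {0<..t})"
    "jump_error e \<in> borel_measurable (restrict_space borel {0<..t})"
    "jump x \<in> borel_measurable (restrict_space borel {0<..t})"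
    "jump (X e) \<in> borel_measurable (restrict_space borel {0<..t})"
proof -
  note [measurable] = measurable_paths[OF t assms]
  have [measurable]: "f \<in> borel_measurable borel" "D \<in> borel_measurable borel"
    using borel_measurable_continuous_onI continuous_f D by auto
  have dd [measurable]: "(\<lambda>s. divided_difference F f (left_lim (X e) s) (X e s)) \<in> borel_measurable (restrict_space borel {0<..t})"
    unfolding borel_measurable_restrict_Ioc_iff
    by (rule cadlag_measurable[OF cadlag_X[OF assms] t divided_difference_continuous[OF F continuous_f]])
  show "(\<lambda>s. f (left_lim x s)) \<in> borel_measurable (restrict_space borel {0<..t})"
    "(\<lambda>s. D (left_lim x s)) \<in> borel_measurable (restrict_space borel {0<..t})" by measurable
  show j: "jump x \<in> borel_measurable (restrict_space borel {0<..t})"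
    "jump (X e) \<in> borel_measurable (restrict_space borel {0<..t})"
    unfolding jump_def[abs_def] by measurable
  note [measurable] = j
  show "taylor_error e \<in> borel_measurable (restrict_space borel {0<..t})"
    unfolding taylor_error_def[abs_def] by measurable
  show "jump_error e \<in> borel_measurable (restrict_space borel {0<..t})"
    unfolding jump_error_def[abs_def] by measurable
  show "(\<lambda>s. divided_difference F f (left_lim (X e) s) (X e s)) \<in> borel_measurable (restrict_space borel {0<..t})"
    by (rule dd)
qed

text \<open>The linear term has to contain \<open>x s - X e s\<close>, because this is the integrand that defines \<open>Q\<close>, whereas
  the expansion at the left limits produces their difference; \<open>jump_error\<close> absorbs the discrepancy.\<close>

lemma integrand_decomposition:
  "divided_difference F f (left_lim (X e) s) (X e s) - f (left_lim x s)
    = taylor_error e s + jump_error e s - D (left_lim x s) * (x s - X e s)"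
  by (simp add: taylor_error_def jump_error_def jump_def algebra_simps)

lemma jump_error_eq:
  "jump_error e s * jump (X e) s = F (X e s) - F (left_lim (X e) s) - f (left_lim (X e) s) * jump (X e) s
    - D (left_lim x s) * (jump (X e) s - jump x s) * jump (X e) s"
  using divided_difference_mult[of F f "left_lim (X e) s" "X e s"]
  by (simp add: jump_error_def jump_def algebra_simps)

text \<open>At a time at which \<open>x\<close> is continuous, so is \<open>X e\<close>, and the divided difference degenerates
  to \<open>f (left_lim (X e) s)\<close>.  Therefore \<open>jump_error\<close> lives on the countable set of jumps of \<open>x\<close>.\<close>

lemma jump_error_zero:
  "0 < e \<Longrightarrow> 0 < s \<Longrightarrow> s \<le> t \<Longrightarrow> s \<notin> jump_times \<Longrightarrow> jump_error e s = 0"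
  using jump_X_zero[of e s] by (simp add: jump_error_def jump_def divided_difference_def)

lemma integrable_terms:
  assumes e: "0 < e"
  shows "ls_integrable (X e) t (\<lambda>s. f (left_lim x s))"
    "ls_integrable (X e) t (taylor_error e)"
    "ls_integrable (X e) t (\<lambda>s. divided_difference F f (left_lim (X e) s) (X e s))"
    "ls_integrable (X e) t (\<lambda>s. D (left_lim x s) * (x s - X e s))"
    "ls_integrable (X e) t (jump_error e)"
    "ls_integrable (X e) t (\<lambda>s. \<bar>jump (X e) s - jump x s\<bar>)"
proof -
  interpret y: fv_path "X e" by (rule fv_path_X[OF e])
  obtain B where B0: "0 \<le> B" "\<forall>s. 0 \<le> s \<longrightarrow> s \<le> t \<longrightarrow> \<bar>x s\<bar> \<le> B"
    using path_bound by blast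
  note B = B0(1) B0(2)[rule_format] path_bounds[OF B0(2)]
  obtain C where C: "0 \<le> C" "\<And>u. \<bar>u\<bar> \<le> B + e \<Longrightarrow> \<bar>f u\<bar> \<le> C" using continuous_bounded_on_ball[OF continuous_f] by blast
  obtain C' where C': "0 \<le> C'" "\<And>u. \<bar>u\<bar> \<le> B + e \<Longrightarrow> \<bar>D u\<bar> \<le> C'" using continuous_bounded_on_ball[OF D] by blast
  note meas [measurable] = measurable_integrands[OF e] measurable_paths[OF t e]
  have lx: "\<bar>left_lim x s\<bar> \<le> B + e" if "0 < s" "s \<le> t" for s using B(3)[OF that] e by linarith
  show "ls_integrable (X e) t (\<lambda>s. f (left_lim x s))"
    by (rule y.ls_integrable_bounded[where B = C]) (auto intro!: C lx)
  show dd: "ls_integrable (X e) t (\<lambda>s. divided_difference F f (left_lim (X e) s) (X e s))"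
    by (rule y.ls_integrable_bounded[where B = C])
       (auto intro!: divided_difference_bounded[OF F C(2)] B e)
  show Dx: "ls_integrable (X e) t (\<lambda>s. D (left_lim x s) * (x s - X e s))"
  proof (rule y.ls_integrable_bounded)
    show "\<bar>D (left_lim x s) * (x s - X e s)\<bar> \<le> C' * e" if "0 < s" "s \<le> t" for s
      unfolding abs_mult using that C' e by (intro mult_mono C'(2) lx close) auto
  qed measurable
  show te: "ls_integrable (X e) t (taylor_error e)"
  proof (rule y.ls_integrable_bounded)
    fix s assume s: "0 < s" "s \<le> t"
    have "\<bar>D (left_lim x s) * (left_lim (X e) s - left_lim x s)\<bar> \<le> C' * e"
      unfolding abs_mult abs_minus_commute[of "left_lim (X e) s"]
      using s C' e by (intro mult_mono C'(2) lx left_lim_close) auto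
    then show "\<bar>taylor_error e s\<bar> \<le> C + C + C' * e"
      unfolding taylor_error_def
      using C(2)[OF lx[OF s]] C(2)[OF B(5)[OF e s]] by linarith
  qed (rule meas)
  have jd: "\<bar>jump (X e) s - jump x s\<bar> \<le> 2 * e" if "0 < s" "s \<le> t" for s
    using close[OF e, of s] left_lim_close[OF e that(1)] that unfolding jump_def by linarith
  show "ls_integrable (X e) t (\<lambda>s. \<bar>jump (X e) s - jump x s\<bar>)"
    by (rule y.ls_integrable_bounded[where B = "2 * e"]) (use jd in auto)
  show "ls_integrable (X e) t (jump_error e)"
  proof (rule y.ls_integrable_bounded)
    fix s assume s: "0 < s" "s \<le> t"
    have "\<bar>D (left_lim x s) * (jump (X e) s - jump x s)\<bar> \<le> C' * (2 * e)"
      unfolding abs_mult using s C' e by (intro mult_mono C'(2) lx jd) auto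
    moreover have "\<bar>divided_difference F f (left_lim (X e) s) (X e s)\<bar> \<le> C"
      by (rule divided_difference_bounded[OF F C(2)]) (use B s e in auto)
    ultimately show "\<bar>jump_error e s\<bar> \<le> C + C + C' * (2 * e)"
      unfolding jump_error_def using C(2)[OF B(5)[OF e s]] by linarith
  qed (rule meas)
qed

text \<open>The integrand decomposition integrated against \<open>X e\<close>, with the chain rule for the divided
  difference and the jump error written as a sum over its atoms.\<close>

lemma ls_integral_identity:
  assumes e: "0 < e"
  shows "ls_integral (X e) t (\<lambda>s. f (left_lim x s))
    = F (X e t) - F (X e 0) + ls_integral (X e) t (\<lambda>s. D (left_lim x s) * (x s - X e s))
      - ls_integral (X e) t (taylor_error e) - (\<Sum>\<^sub>\<infinity>s\<in>jump_times. jump_error e s * jump (X e) s)"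
proof -
  interpret y: fv_path "X e" by (rule fv_path_X[OF e])
  note i = integrable_terms[OF e]
  define dd where "dd s = divided_difference F f (left_lim (X e) s) (X e s)" for s
  have i3: "ls_integrable (X e) t dd" using i(3) by (simp add: dd_def[abs_def])
  have "ls_integral (X e) t (\<lambda>s. dd s - f (left_lim x s))
      = ls_integral (X e) t (\<lambda>s. taylor_error e s + jump_error e s - D (left_lim x s) * (x s - X e s))"
    by (simp only: dd_def integrand_decomposition)
  moreover have "ls_integrable (X e) t (\<lambda>s. taylor_error e s + jump_error e s)"
    using i(2,5) by (simp add: ls_integrable_iff distrib_left)
  ultimately have "ls_integral (X e) t dd - ls_integral (X e) t (\<lambda>s. f (left_lim x s))
      = ls_integral (X e) t (taylor_error e) + ls_integral (X e) t (jump_error e)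
        - ls_integral (X e) t (\<lambda>s. D (left_lim x s) * (x s - X e s))"
    using y.ls_integral_diff[OF i3 i(1)] y.ls_integral_diff[OF _ i(4), of "\<lambda>s. taylor_error e s + jump_error e s"]
      y.ls_integral_add[OF i(2,5)] by simp
  moreover have "ls_integral (X e) t dd = F (X e t) - F (X e 0)"
    using y.chain_rule[OF F continuous_f t] by (simp add: dd_def[abs_def])
  moreover have "(\<Sum>\<^sub>\<infinity>s\<in>jump_times. jump_error e s * jump (X e) s) = ls_integral (X e) t (jump_error e)"
    by (intro infsumI y.ls_integral_jumps i jump_times jump_error_zero e)
  ultimately show ?thesis by linarith
qed

text \<open>The differences of the jumps vanish off the jump times, so this integral is a sum of
  products of jumps.\<close>

lemma jump_error_mass_bounded:
  assumes e: "0 < e"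
  shows "(\<integral>s. indicator {0<..t} s * \<bar>jump (X e) s - jump x s\<bar> \<partial>variation_measure (X e))
    \<le> (\<bar>K\<bar> + 1) * \<bar>K\<bar> * (\<Sum>\<^sub>\<infinity>s\<in>jump_times. (jump x s)\<^sup>2)"
proof -
  interpret y: fv_path "X e" by (rule fv_path_X[OF e])
  have "((\<lambda>s. \<bar>jump (X e) s - jump x s\<bar> * \<bar>jump (X e) s\<bar>)
      has_sum (\<integral>s. indicator {0<..t} s * \<bar>jump (X e) s - jump x s\<bar> \<partial>variation_measure (X e))) jump_times"
    using jump_X_zero[OF e] by (intro y.integral_jumps integrable_terms e jump_times) auto
  moreover have "((\<lambda>s. (\<bar>K\<bar> + 1) * \<bar>K\<bar> * (jump x s)\<^sup>2) has_sum (\<bar>K\<bar> + 1) * \<bar>K\<bar> * (\<Sum>\<^sub>\<infinity>s\<in>jump_times. (jump x s)\<^sup>2)) jump_times"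
    by (intro has_sum_cmult_right has_sum_infsum squares_on_jump_times)
  ultimately show ?thesis
    by (rule has_sum_mono) (use jump_times(2) in \<open>auto intro!: jump_error_bound e\<close>)
qed

text \<open>Uniform continuity of \<open>D\<close> makes the Taylor error at most \<open>r\<close> times the distance of the left limits, with
  \<open>r\<close> as small as desired.  That distance is at most \<open>\<bar>x s - X e s\<bar>\<close> plus the difference of the jumps, and both have bounded
  integrals against the variation measures.\<close>

lemma taylor_error_limit: "((\<lambda>e. ls_integral (X e) t (taylor_error e)) \<longlongrightarrow> 0) (at_right 0)"
proof (rule tendstoI)
  fix w :: real assume w: "0 < w"
  obtain M where M: "0 \<le> M" "\<And>e. 0 < e \<Longrightarrow> error_mass e t \<le> M" using error_mass_bounded[OF t] by blast
  define N where "N = (\<bar>K\<bar> + 1) * \<bar>K\<bar> * (\<Sum>\<^sub>\<infinity>s\<in>jump_times. (jump x s)\<^sup>2)"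
  have N: "0 \<le> N" unfolding N_def by (intro mult_nonneg_nonneg infsum_nonneg) auto
  define r where "r = w / (M + N + 1)"
  have r: "0 < r" using w M N by (simp add: r_def)
  obtain B where B0: "0 \<le> B" "\<forall>s. 0 \<le> s \<longrightarrow> s \<le> t \<longrightarrow> \<bar>x s\<bar> \<le> B"
    using path_bound by blast
  note B = path_bounds(1)[OF B0(2)]
  obtain d where d: "0 < d"
    "\<And>a b. \<bar>a\<bar> \<le> B \<Longrightarrow> \<bar>b - a\<bar> < d \<Longrightarrow> \<bar>f b - f a - D a * (b - a)\<bar> \<le> r * \<bar>b - a\<bar>"
    using taylor_first_order[OF f D r] by blast
  have "\<forall>\<^sub>F e in at_right 0. 0 < e \<and> e < d"
    using d(1) by (auto simp: eventually_at_right_field intro!: exI[of _ d])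
  then show "\<forall>\<^sub>F e in at_right 0. dist (ls_integral (X e) t (taylor_error e)) 0 < w"
  proof eventually_elim
    case (elim e)
    then have e: "0 < e" by simp
    interpret y: fv_path "X e" by (rule fv_path_X[OF e])
    note i = error_integrable(2)[OF t e] integrable_terms(6)[OF e]
    have "\<bar>ls_integral (X e) t (taylor_error e)\<bar>
        \<le> (\<integral>s. indicator {0<..t} s * (r * \<bar>x s - X e s\<bar> + r * \<bar>jump (X e) s - jump x s\<bar>) \<partial>variation_measure (X e))"
    proof (rule y.abs_ls_integral_le[OF integrable_terms(2)[OF e]])
      show "ls_integrable (X e) t (\<lambda>s. r * \<bar>x s - X e s\<bar> + r * \<bar>jump (X e) s - jump x s\<bar>)"
        using i by (simp add: ls_integrable_iff distrib_left mult.left_commute[of _ r])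
      fix s assume s: "0 < s" "s \<le> t"
      have "\<bar>left_lim (X e) s - left_lim x s\<bar> < d" using left_lim_close[OF e s(1)] elim by linarith
      then have "\<bar>taylor_error e s\<bar> \<le> r * \<bar>left_lim (X e) s - left_lim x s\<bar>"
        unfolding taylor_error_def by (intro d(2) B s)
      also have "\<dots> \<le> r * (\<bar>x s - X e s\<bar> + \<bar>jump (X e) s - jump x s\<bar>)"
      proof (rule mult_left_mono)
        show "\<bar>left_lim (X e) s - left_lim x s\<bar> \<le> \<bar>x s - X e s\<bar> + \<bar>jump (X e) s - jump x s\<bar>"
          unfolding jump_def by linarith
      qed (use r in simp)
      finally show "\<bar>taylor_error e s\<bar> \<le> r * \<bar>x s - X e s\<bar> + r * \<bar>jump (X e) s - jump x s\<bar>"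
        by (simp add: distrib_left)
    qed
    also have "\<dots> = r * error_mass e t
        + r * (\<integral>s. indicator {0<..t} s * \<bar>jump (X e) s - jump x s\<bar> \<partial>variation_measure (X e))"
      using i by (simp add: distrib_left mult.left_commute[of _ r] ls_integrable_iff error_mass_def)
    also have "\<dots> \<le> r * M + r * N"
      using M(2)[OF e] jump_error_mass_bounded[OF e] r unfolding N_def by (intro add_mono mult_left_mono) auto
    also have "\<dots> < w"
    proof -
      have "r * (M + N + 1) = w" using M(1) N by (simp add: r_def)
      then have "w = r * M + r * N + r" by (simp add: distrib_left)
      then show ?thesis using r by linarith
    qed
    finally show ?case by simp
  qed
qed

text \<open>A common multiple of the squared jumps of \<open>x\<close> dominates the terms of the jump sum and of all its
  approximations.  For the jump term itself this is the second order Taylor estimate; for the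
  approximations the squared jumps of \<open>X e\<close> are first compared with those of \<open>x\<close>.\<close>

lemma jump_term_bound:
  obtains C where "0 \<le> C" "\<And>s. 0 < s \<Longrightarrow> s \<le> t \<Longrightarrow> \<bar>jump_term s\<bar> \<le> C * (jump x s)\<^sup>2"
    "\<And>e s. 0 < e \<Longrightarrow> e \<le> 1 \<Longrightarrow> 0 < s \<Longrightarrow> s \<le> t \<Longrightarrow> \<bar>jump_error e s * jump (X e) s\<bar> \<le> C * (jump x s)\<^sup>2"
proof -
  obtain B where B0: "0 \<le> B" "\<forall>s. 0 \<le> s \<longrightarrow> s \<le> t \<longrightarrow> \<bar>x s\<bar> \<le> B"
    using path_bound by blast
  note B = B0(1) B0(2)[rule_format] path_bounds[OF B0(2)]
  obtain C where C: "0 \<le> C" "\<And>u. \<bar>u\<bar> \<le> B + 1 \<Longrightarrow> \<bar>D u\<bar> \<le> C" using continuous_bounded_on_ball[OF D] by blast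
  let ?C = "C + C * \<bar>K\<bar>\<^sup>2 + C * ((\<bar>K\<bar> + 1) * \<bar>K\<bar>)"
  have nn: "0 \<le> C * \<bar>K\<bar>\<^sup>2" "0 \<le> C * ((\<bar>K\<bar> + 1) * \<bar>K\<bar>)" using C(1) by auto
  show ?thesis
  proof (rule that[of ?C])
    show "0 \<le> ?C" using nn C by linarith
  next
    fix s assume s: "0 < s" "s \<le> t"
    have "\<bar>jump_term s\<bar> \<le> C * (jump x s)\<^sup>2"
      unfolding jump_term_def jump_def using B(2)[of s] B(3)[OF s] s
      by (intro taylor_second_order[OF F f C(2)]) auto
    also have "\<dots> \<le> ?C * (jump x s)\<^sup>2" using nn by (intro mult_right_mono) auto
    finally show "\<bar>jump_term s\<bar> \<le> ?C * (jump x s)\<^sup>2" .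
  next
    fix e s :: real assume e: "0 < e" "e \<le> 1" and s: "0 < s" "s \<le> t"
    have "\<bar>F (X e s) - F (left_lim (X e) s) - f (left_lim (X e) s) * jump (X e) s\<bar> \<le> C * (jump (X e) s)\<^sup>2"
      unfolding jump_def using B(4)[OF e(1), of s] B(5)[OF e(1) s] s e
      by (intro taylor_second_order[OF F f C(2)]) auto
    also have "\<dots> \<le> C * (\<bar>K\<bar> * \<bar>jump x s\<bar>)\<^sup>2"
      using jump_X_bound[OF e(1) s(1)] C(1) by (intro mult_left_mono) (metis abs_ge_zero power2_abs power_mono)+
    finally have 1: "\<bar>F (X e s) - F (left_lim (X e) s) - f (left_lim (X e) s) * jump (X e) s\<bar> \<le> C * \<bar>K\<bar>\<^sup>2 * (jump x s)\<^sup>2"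
      by (simp add: power_mult_distrib)
    have "\<bar>D (left_lim x s) * (jump (X e) s - jump x s) * jump (X e) s\<bar>
        = \<bar>D (left_lim x s)\<bar> * (\<bar>jump (X e) s - jump x s\<bar> * \<bar>jump (X e) s\<bar>)" by (simp add: abs_mult)
    also have "\<dots> \<le> C * ((\<bar>K\<bar> + 1) * \<bar>K\<bar> * (jump x s)\<^sup>2)"
      using C(1) B(3)[OF s] by (intro mult_mono C(2) jump_error_bound e s) auto
    finally have 2: "\<bar>D (left_lim x s) * (jump (X e) s - jump x s) * jump (X e) s\<bar> \<le> C * ((\<bar>K\<bar> + 1) * \<bar>K\<bar>) * (jump x s)\<^sup>2"
      by (simp add: mult.assoc)
    have "0 \<le> C * (jump x s)\<^sup>2" using C(1) by simp
    then show "\<bar>jump_error e s * jump (X e) s\<bar> \<le> ?C * (jump x s)\<^sup>2"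
      unfolding jump_error_eq distrib_right[of _ _ "(jump x s)\<^sup>2"] using 1 2 by linarith
  qed
qed

lemma jump_term_summable: "jump_term summable_on {0<..t}"
proof -
  obtain C where J: "0 \<le> C" "\<And>s. 0 < s \<Longrightarrow> s \<le> t \<Longrightarrow> \<bar>jump_term s\<bar> \<le> C * (jump x s)\<^sup>2"
    "\<And>e s. 0 < e \<Longrightarrow> e \<le> 1 \<Longrightarrow> 0 < s \<Longrightarrow> s \<le> t \<Longrightarrow> \<bar>jump_error e s * jump (X e) s\<bar> \<le> C * (jump x s)\<^sup>2"
    using jump_term_bound by blast
  note C = J(2)
  have "(\<lambda>s. C * (jump x s)\<^sup>2) summable_on {0<..t}"
    by (intro summable_on_cmult_right jumps_square_summable t)
  then have "(\<lambda>s. \<bar>jump_term s\<bar>) summable_on {0<..t}"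
    by (rule summable_on_comparison_test) (auto intro: C)
  then show ?thesis using summable_on_iff_abs_summable_on_real[of jump_term "{0<..t}"] by simp
qed

lemma jump_term_infsum: "(\<Sum>\<^sub>\<infinity>s\<in>jump_times. jump_term s) = (\<Sum>\<^sub>\<infinity>s\<in>{0<..t}. jump_term s)"
  by (rule infsum_cong_neutral) (auto simp: jump_times_def jump_term_def jump_def)

lemma approximation_limits:
  assumes "0 \<le> s"
  shows "((\<lambda>e. X e s) \<longlongrightarrow> x s) (at_right 0)"
    "0 < s \<Longrightarrow> ((\<lambda>e. left_lim (X e) s) \<longlongrightarrow> left_lim x s) (at_right 0)"
proof -
  have zero: "((\<lambda>e::real. e) \<longlongrightarrow> 0) (at_right 0)" by (rule tendsto_ident_at)
  have "((\<lambda>e. X e s - x s) \<longlongrightarrow> 0) (at_right 0)"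
    by (rule Lim_null_comparison[OF _ zero], rule eventually_mono[OF eventually_pos])
       (use close assms in \<open>simp add: abs_minus_commute\<close>)
  then show "((\<lambda>e. X e s) \<longlongrightarrow> x s) (at_right 0)" by (rule LIM_zero_cancel)
  assume s: "0 < s"
  have "((\<lambda>e. left_lim (X e) s - left_lim x s) \<longlongrightarrow> 0) (at_right 0)"
    by (rule Lim_null_comparison[OF _ zero], rule eventually_mono[OF eventually_pos])
       (use left_lim_close s in \<open>simp add: abs_minus_commute\<close>)
  then show "((\<lambda>e. left_lim (X e) s) \<longlongrightarrow> left_lim x s) (at_right 0)" by (rule LIM_zero_cancel)
qed

lemma jump_error_limit:
  "((\<lambda>e. \<Sum>\<^sub>\<infinity>s\<in>jump_times. jump_error e s * jump (X e) s) \<longlongrightarrow> (\<Sum>\<^sub>\<infinity>s\<in>{0<..t}. jump_term s)) (at_right 0)"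
  unfolding jump_term_infsum[symmetric]
proof -
  obtain C where J: "0 \<le> C" "\<And>s. 0 < s \<Longrightarrow> s \<le> t \<Longrightarrow> \<bar>jump_term s\<bar> \<le> C * (jump x s)\<^sup>2"
    "\<And>e s. 0 < e \<Longrightarrow> e \<le> 1 \<Longrightarrow> 0 < s \<Longrightarrow> s \<le> t \<Longrightarrow> \<bar>jump_error e s * jump (X e) s\<bar> \<le> C * (jump x s)\<^sup>2"
    using jump_term_bound by blast
  note C = J(3)
  have cont: "isCont F u" "isCont f u" for u using F f DERIV_isCont by blast+
  show "((\<lambda>e. \<Sum>\<^sub>\<infinity>s\<in>jump_times. jump_error e s * jump (X e) s) \<longlongrightarrow> (\<Sum>\<^sub>\<infinity>s\<in>jump_times. jump_term s)) (at_right 0)"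
  proof (rule tendsto_infsum_dominated)
    have "\<forall>\<^sub>F e in at_right 0. 0 < e \<and> e < (1::real)"
      by (auto simp: eventually_at_right_field intro!: exI[of _ 1])
    then show "\<forall>\<^sub>F e in at_right 0. \<forall>s\<in>jump_times. \<bar>jump_error e s * jump (X e) s\<bar> \<le> C * (jump x s)\<^sup>2"
      by (rule eventually_mono) (use jump_times(2) C in force)
    show "(\<lambda>s. C * (jump x s)\<^sup>2) summable_on jump_times"
      by (intro summable_on_cmult_right squares_on_jump_times)
    fix s assume "s \<in> jump_times"
    then have s: "0 \<le> s" "0 < s" using jump_times(2) by auto
    note l = approximation_limits(1)[OF s(1)] approximation_limits(2)[OF s]
    have j: "((\<lambda>e. jump (X e) s) \<longlongrightarrow> jump x s) (at_right 0)"
      unfolding jump_def by (intro tendsto_diff l)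
    have "((\<lambda>e. jump_error e s * jump (X e) s) \<longlongrightarrow> F (x s) - F (left_lim x s) - f (left_lim x s) * jump x s
        - D (left_lim x s) * (jump x s - jump x s) * jump x s) (at_right 0)"
      unfolding jump_error_eq
      by (intro tendsto_diff tendsto_mult tendsto_const isCont_tendsto_compose[OF cont(1)] isCont_tendsto_compose[OF cont(2)] l j)
    then show "((\<lambda>e. jump_error e s * jump (X e) s) \<longlongrightarrow> jump_term s) (at_right 0)"
      by (simp add: jump_term_def)
  qed simp
qed

lemma D_left_lim_bounded:
  obtains C where "\<And>s. 0 < s \<Longrightarrow> s \<le> t \<Longrightarrow> \<bar>D (left_lim x s)\<bar> \<le> C"
proof -
  obtain B where B0: "0 \<le> B" "\<forall>s. 0 \<le> s \<longrightarrow> s \<le> t \<longrightarrow> \<bar>x s\<bar> \<le> B"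
    using path_bound by blast
  note B = path_bounds(1)[OF B0(2)]
  obtain C where C: "0 \<le> C" "\<And>u. \<bar>u\<bar> \<le> B \<Longrightarrow> \<bar>D u\<bar> \<le> C"
    using continuous_bounded_on_ball[OF D] by blast
  show ?thesis by (rule that[of C]) (intro C(2) B)
qed

text \<open>The integrand \<open>D (left_lim x s)\<close> is left continuous with right limits, because left limits of a cadlag path
  are and \<open>D\<close> is continuous.\<close>

lemma quadratic_limit:
  "((\<lambda>e. ls_integral (X e) t (\<lambda>s. D (left_lim x s) * (x s - X e s)))
     \<longlongrightarrow> 1/2 * ls_integral Q t (\<lambda>s. D (left_lim x s))) (at_right 0)"
proof -
  obtain C where C: "\<And>s. 0 < s \<Longrightarrow> s \<le> t \<Longrightarrow> \<bar>D (left_lim x s)\<bar> \<le> C" using D_left_lim_bounded by blast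
  have cont: "isCont D u" for u using D by (simp add: continuous_on_eq_continuous_at)
  show ?thesis
  proof (rule weighted_error_limit[OF t _ _ measurable_integrands(2)[OF zero_less_one] C])
    show "((\<lambda>s. D (left_lim x s)) \<longlongrightarrow> D (left_lim x s)) (at_left s)" if "0 < s" for s
      by (intro isCont_tendsto_compose[OF cont] left_lim_left_continuous cadlag_x that)
    show "\<exists>m. ((\<lambda>s. D (left_lim x s)) \<longlongrightarrow> m) (at_right s)" if "0 \<le> s" for s
      using isCont_tendsto_compose[OF cont left_lim_right_limit[OF cadlag_x that]] by blast
  qed
qed

lemma integrable_Q: "ls_integrable Q t (\<lambda>s. D (left_lim x s))"
proof -
  obtain C where C: "\<And>s. 0 < s \<Longrightarrow> s \<le> t \<Longrightarrow> \<bar>D (left_lim x s)\<bar> \<le> C" using D_left_lim_bounded by blast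
  show ?thesis
    by (rule fv_path.ls_integrable_bounded[OF fv_path_Q measurable_integrands(2)[OF zero_less_one] C])
qed

lemma ls_integral_limit:
  "((\<lambda>e. ls_integral (X e) t (\<lambda>s. f (left_lim x s)))
     \<longlongrightarrow> F (x t) - F (x 0) + 1/2 * ls_integral Q t (\<lambda>s. D (left_lim x s)) - (\<Sum>\<^sub>\<infinity>s\<in>{0<..t}. jump_term s)) (at_right 0)"
proof -
  have cont: "isCont F u" for u using F DERIV_isCont by blast
  have "((\<lambda>e. F (X e t) - F (X e 0) + ls_integral (X e) t (\<lambda>s. D (left_lim x s) * (x s - X e s))
        - ls_integral (X e) t (taylor_error e) - (\<Sum>\<^sub>\<infinity>s\<in>jump_times. jump_error e s * jump (X e) s))
      \<longlongrightarrow> F (x t) - F (x 0) + 1/2 * ls_integral Q t (\<lambda>s. D (left_lim x s)) - 0 - (\<Sum>\<^sub>\<infinity>s\<in>{0<..t}. jump_term s)) (at_right 0)"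
    using t by (intro tendsto_diff tendsto_add isCont_tendsto_compose[OF cont] approximation_limits
        quadratic_limit taylor_error_limit jump_error_limit) auto
  then show ?thesis
    unfolding diff_zero
    by (rule Lim_transform_eventually) (rule eventually_mono[OF eventually_pos], simp add: ls_integral_identity)
qed

end

theorem theorem2:
  fixes x :: "real \<Rightarrow> real" and X :: "real \<Rightarrow> real \<Rightarrow> real" and Q :: "real \<Rightarrow> real"
    and K :: real and f F :: "real \<Rightarrow> real" and t :: real
  assumes "cadlag x"
    and "\<And>t. t > 0 \<Longrightarrow> (\<lambda>s. (jump x s)\<^sup>2) summable_on {0<..t}"
    and "\<And>\<epsilon>. \<epsilon> > 0 \<Longrightarrow> cadlag (X \<epsilon>)"
    and "\<And>\<epsilon> s. \<epsilon> > 0 \<Longrightarrow> s \<ge> 0 \<Longrightarrow> \<bar>x s - X \<epsilon> s\<bar> \<le> \<epsilon>"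
    and "\<And>\<epsilon>. \<epsilon> > 0 \<Longrightarrow> finite_variation (X \<epsilon>)"
    and "\<And>T. T \<ge> 0 \<Longrightarrow>
           uniform_limit {0..T} (\<lambda>\<epsilon> t. 2 * ls_integral (X \<epsilon>) t (\<lambda>s. x s - X \<epsilon> s)) Q (at_right 0)"
    and "\<And>t. t > 0 \<Longrightarrow>
           (SUP \<epsilon>\<in>{0<..}. \<integral>\<^sup>+s\<in>{0<..t}. ennreal \<bar>x s - X \<epsilon> s\<bar> \<partial>variation_measure (X \<epsilon>)) < \<infinity>"
    and "\<And>\<epsilon> t. \<epsilon> > 0 \<Longrightarrow> t > 0 \<Longrightarrow> \<bar>jump (X \<epsilon>) t\<bar> \<le> K * \<bar>jump x t\<bar>"
    and "f C1_differentiable_on UNIV"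
    and "\<And>u. (F has_real_derivative f u) (at u)"
    and "t > 0"
  shows "cadlag Q \<and> finite_variation Q \<and>
         ls_integrable Q t (\<lambda>s. deriv f (left_lim x s)) \<and>
         (\<forall>\<epsilon>>0. ls_integrable (X \<epsilon>) t (\<lambda>s. f (left_lim x s))) \<and>
         (\<lambda>s. F (x s) - F (left_lim x s) - f (left_lim x s) * jump x s) summable_on {0<..t} \<and>
         (\<exists>I. ((\<lambda>\<epsilon>. ls_integral (X \<epsilon>) t (\<lambda>s. f (left_lim x s))) \<longlongrightarrow> I) (at_right 0) \<and>
              F (x t) - F (x 0) =
                I - 1 / 2 * ls_integral Q t (\<lambda>s. deriv f (left_lim x s)) +
                (\<Sum>\<^sub>\<infinity>s\<in>{0<..t}. F (x s) - F (left_lim x s) - f (left_lim x s) * jump x s))"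
proof -
  obtain D where D: "\<And>u. (f has_real_derivative D u) (at u)" "continuous_on UNIV D"
    using assms(9) unfolding C1_differentiable_on_def
    by (auto simp: has_real_derivative_iff_has_vector_derivative)
  have deriv: "deriv f = D" using D(1) DERIV_imp_deriv by blast
  interpret ito_setting x X Q K f D F t
    by unfold_locales (fact assms D)+
  show ?thesis
    unfolding deriv using cadlag_Q finite_variation_Q integrable_Q integrable_terms(1) jump_term_summable ls_integral_limit
    unfolding jump_term_def[abs_def] by auto
qed

end
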